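(* Let $\{\lambda,\underline m\}$ be a pointed knapsack partition of $n$ with $m>0$, where $\lambda$ has $k$ parts. The cycles $g_{\alpha,\vec d}=\sum_{\gamma\in\mathfrak S^c_{\vec d}}\sum_{\vec c\in W(\vec d)}(-1)^\gamma(-1)^{\vec c}\,\sigma(\alpha\circ\gamma,\vec c)$, where $\vec d$ ranges over $V(\lambda,\underline m)$ and $\alpha$ ranges over all permutations in $\mathfrak S_n$ with descent composition $\vec d$, form a basis for the homology group $\widetilde H_{k-1}(\Lambda_{\{\lambda,\underline m\}})$.
   Context: A knapsack partition is a multiset $\lambda=\{\lambda_1^{e_1},\dots,\lambda_q^{e_q}\}$ of positive integers ($\lambda_i$ distinct) such that the sums $\sum f_i\lambda_i$, $0\le f_i\le e_i$, are pairwise distinct; a pointed knapsack partition $\{\lambda,\underline m\}$ of $n$ adds an integer $m\ge0$ with total sum $n$. Pointed set partitions of $[n]$: $\{B_1,\dots,B_j,\underline Z\}$, $Z\subseteq[n]$ possibly empty, $B_i$ nonempty partitioning $[n]\setminus Z$; type = multiset $\{|B_i|\}$ with pointed number $|Z|$; $\Pi^\bullet_n$ ordered by $\pi\le\pi'$ iff each non-pointed block of $\pi$ lies in a block of $\pi'$ and the pointed block of $\pi$ lies in that of $\pi'$. $\Pi^\bullet_{\{\lambda,\underline m\}}$ is the filter generated by pointed set partitions of type $\{\lambda,\underline m\}$. An ordered set partition of $[n]$ is $(C_1,\dots,C_r)$, disjoint with union $[n]$, $C_1,\dots,C_{r-1}$ nonempty, $C_r$ possibly empty; $\Delta_n$ has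 these as faces ($(C_1,\dots,C_r)$ of dimension $r-2$, faces by merging consecutive blocks, $([n])$ empty face); $\Lambda_{\{\lambda,\underline m\}}$ is the subcomplex of $(C_1,\dots,C_r)$ with $\{C_1,\dots,C_{r-1},\underline{C_r}\}\in\Pi^\bullet_{\{\lambda,\underline m\}}$. Chains: $\partial(C_1,\dots,C_r)=\sum_{i=1}^{r-1}(-1)^{i-1}(C_1,\dots,C_i\cup C_{i+1},\dots,C_r)$; reduced homology with coefficients in a fixed field. Pointed compositions $(c_1,\dots,c_r)$ ($c_i\ge1$ for $i<r$, $c_r\ge0$, sum $n$) are ordered by $\vec c\le\vec d$ iff $\vec d$ arises by replacing runs of consecutive entries by their sums; type = multiset $\{c_1,\dots,c_{r-1}\}$ with pointed $c_r$. With $F$ the filter generated by compositions of type $\{\lambda,\underline m\}$, $V(\lambda,\underline m)$ is the set of $\vec d=(d_1,\dots,d_r)\in F$ with $d_r=m$ and each $d_i$ ($i<r$) a sum of parts of $\lambda$ of pairwise distinct values. $\epsilon(\vec d)$ replaces each $d_i$ ($i<r$) by the strictly decreasing list of parts of $\lambda$ summing to it (using all parts of $\lambda$), keeping last part $m$. $W(\vec d)=\{\vec c\in V(\lambda,\underline m):\vec c\le\vec d,\ \operatorname{type}(\vec c)=\{\lambda,\underline m\}\}$; for $\vec c\in W(\vec d)$, each $d_i$ splits into $t_i$ consecutive parts of $\vec c$ that are a rearrangement of the corresponding parts of $\epsilon(\vec d)$, via a unique $\rho\in\mathfrak S_{t_1}\times\cdots\times\mathfrak S_{t_r}$, and $(-1)^{\vec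 c}=\operatorname{sign}(\rho)$. For $\alpha\in\mathfrak S_n$ and $\vec c=(c_1,\dots,c_s)$, $\sigma(\alpha,\vec c)=(\{\alpha_j:j\in R_1\},\dots,\{\alpha_j:j\in R_s\})$, $R_i=[c_1+\dots+c_{i-1}+1,c_1+\dots+c_i]$; $\alpha\circ\gamma$ is $j\mapsto\alpha_{\gamma(j)}$; $(-1)^\gamma$ is the sign. Descent composition of $\alpha$ with descent set $\{s_1<\dots<s_{p-1}\}$: $(s_1,s_2-s_1,\dots,n-s_{p-1})$. For $\vec d=(d_1,\dots,d_r)$, the column intervals $K_1,\dots,K_{n-r+1}$ are the maximal intervals of $[n]$ such that $j,j+1$ lie in the same interval iff $j\in\{d_1,d_1+d_2,\dots,d_1+\dots+d_{r-1}\}$, and $\mathfrak S^c_{\vec d}=\mathfrak S_{K_1}\times\cdots\times\mathfrak S_{K_{n-r+1}}$. *)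

theory Defs
  imports
    "Jordan_Normal_Form.VS_Connect"
    "HOL-Combinatorics.Permutations"
    "HOL-Library.Disjoint_Sets"
    "HOL-Library.Poly_Mapping"
begin

section \<open>Pointed knapsack partitions and pointed set partitions\<close>

text \<open>A choice of $0 \le f_i \le e_i$ is the same thing as a submultiset of the partition,
  the $f_i$ being its multiplicities.\<close>

definition knapsack_partition :: "nat multiset \<Rightarrow> bool" where
  "knapsack_partition lam \<longleftrightarrow> 0 \<notin># lam \<and> inj_on sum_mset {A. A \<subseteq># lam}"

definition pointed_knapsack_partition :: "nat multiset \<Rightarrow> nat \<Rightarrow> nat \<Rightarrow> bool" where
  "pointed_knapsack_partition lam m n \<longleftrightarrow> knapsack_partition lam \<and> sum_mset lam + m = n"

text \<open>A pointed set partition is a pair \<open>(B, Z)\<close> of the set \<open>B\<close> of non-pointed blocks and the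
  pointed block \<open>Z\<close>.\<close>

definition pointed_set_partitions :: "nat \<Rightarrow> (nat set set \<times> nat set) set" where
  "pointed_set_partitions n = {(B, Z). Z \<subseteq> {1..n} \<and> partition_on ({1..n} - Z) B}"

definition psp_type :: "nat set set \<times> nat set \<Rightarrow> nat multiset \<times> nat" where
  "psp_type = (\<lambda>(B, Z). (image_mset card (mset_set B), card Z))"

text \<open>The block of the coarser partition that contains a non-pointed block may be the pointed one.\<close>

definition psp_le :: "nat set set \<times> nat set \<Rightarrow> nat set set \<times> nat set \<Rightarrow> bool" where
  "psp_le = (\<lambda>(B, Z) (B', Z'). (\<forall>X\<in>B. \<exists>Y\<in>insert Z' B'. X \<subseteq> Y) \<and> Z \<subseteq> Z')"

definition psp_filter :: "nat multiset \<Rightarrow> nat \<Rightarrow> nat \<Rightarrow> (nat set set \<times> nat set) set" where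
  "psp_filter lam m n = {\<pi> \<in> pointed_set_partitions n.
     \<exists>\<pi>0 \<in> pointed_set_partitions n. psp_type \<pi>0 = (lam, m) \<and> psp_le \<pi>0 \<pi>}"


section \<open>The complex of ordered set partitions\<close>

definition ordered_set_partitions :: "nat \<Rightarrow> nat set list set" where
  "ordered_set_partitions n = {C. C \<noteq> [] \<and> {} \<notin> set (butlast C) \<and> \<Union>(set C) = {1..n} \<and>
     (\<forall>i j. i < j \<and> j < length C \<longrightarrow> C ! i \<inter> C ! j = {})}"

definition Lambda_complex :: "nat multiset \<Rightarrow> nat \<Rightarrow> nat \<Rightarrow> nat set list set" where
  "Lambda_complex lam m n =
     {C \<in> ordered_set_partitions n. (set (butlast C), last C) \<in> psp_filter lam m n}"


section \<open>Reduced homology\<close>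

text \<open>A chain is a finitely supported function on faces. A face with $r$ blocks has dimension
  $r - 2$, and the one-block face is the empty face, so degrees are integers and the homology
  below is reduced.\<close>

definition chains :: "'a set list set \<Rightarrow> int \<Rightarrow> ('a set list \<Rightarrow>\<^sub>0 'k::field) set" where
  "chains K p = {z. Poly_Mapping.keys z \<subseteq> {C \<in> K. int (length C) - 2 = p}}"

text \<open>\<open>merge C i\<close> unites the blocks at the list positions \<open>i\<close> and \<open>i + 1\<close>, which are the blocks
  $C_{i+1}$ and $C_{i+2}$ in one-based numbering; hence the sign $(-1)^i$ in the boundary.\<close>

definition merge :: "'a set list \<Rightarrow> nat \<Rightarrow> 'a set list" where
  "merge C i = take i C @ [C ! i \<union> C ! Suc i] @ drop (i + 2) C"

definition boundary :: "('a set list \<Rightarrow>\<^sub>0 'k::field) \<Rightarrow> ('a set list \<Rightarrow>\<^sub>0 'k)" where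
  "boundary z = (\<Sum>C\<in>Poly_Mapping.keys z. \<Sum>i<length C - 1.
     Poly_Mapping.single (merge C i) ((-1) ^ i * Poly_Mapping.lookup z C))"

definition chain_scale :: "'k::field \<Rightarrow> ('b \<Rightarrow>\<^sub>0 'k) \<Rightarrow> ('b \<Rightarrow>\<^sub>0 'k)" where
  "chain_scale a z = Poly_Mapping.map ((*) a) z"

definition cycles :: "'a set list set \<Rightarrow> int \<Rightarrow> ('a set list \<Rightarrow>\<^sub>0 'k::field) set" where
  "cycles K p = {z \<in> chains K p. boundary z = 0}"

definition boundaries :: "'a set list set \<Rightarrow> int \<Rightarrow> ('a set list \<Rightarrow>\<^sub>0 'k::field) set" where
  "boundaries K p = boundary ` chains K (p + 1)"

definition homology_class ::
  "'a set list set \<Rightarrow> int \<Rightarrow> ('a set list \<Rightarrow>\<^sub>0 'k::field) \<Rightarrow> ('a set list \<Rightarrow>\<^sub>0 'k) set" where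
  "homology_class K p z = {z + b | b. b \<in> boundaries K p}"

text \<open>The quotient space of cycles by boundaries, with the setwise operations on cosets. The fields
  \<open>mult\<close> and \<open>one\<close> come from the record type and play no role in a module. Adding \<open>b\<close> in the
  scalar multiplication makes the result a full coset also for the scalar \<open>0\<close>.\<close>

definition homology ::
  "'a set list set \<Rightarrow> int \<Rightarrow> ('k::field, ('a set list \<Rightarrow>\<^sub>0 'k) set) module" where
  "homology K p = \<lparr>
     carrier = homology_class K p ` cycles K p,
     mult = undefined, one = undefined,
     zero = boundaries K p,
     add = (\<lambda>X Y. {x + y | x y. x \<in> X \<and> y \<in> Y}),
     smult = (\<lambda>a X. {chain_scale a x + b | x b. x \<in> X \<and> b \<in> boundaries K p}) \<rparr>"

lemma lookup_chain_scale [simp]: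
  "Poly_Mapping.lookup (chain_scale a z) x = a * Poly_Mapping.lookup z x"
  unfolding chain_scale_def by (simp add: Poly_Mapping.map.rep_eq when_def)

lemma chain_scale_laws:
  "chain_scale a (x + y) = chain_scale a x + chain_scale a y"
  "chain_scale (a + b) x = chain_scale a x + chain_scale b x"
  "chain_scale (a * b) x = chain_scale a (chain_scale b x)"
  "chain_scale 1 x = x"
  "chain_scale a 0 = 0"
  "chain_scale (-1) x = - x"
  by (rule poly_mapping_eqI; simp add: lookup_add algebra_simps)+

lemma boundary_superset:
  assumes "finite S" "Poly_Mapping.keys z \<subseteq> S"
  shows "boundary z = (\<Sum>C\<in>S. \<Sum>i<length C - 1.
     Poly_Mapping.single (merge C i) ((-1) ^ i * Poly_Mapping.lookup z C))"
  unfolding boundary_def using assms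
  by (intro sum.mono_neutral_left) (auto simp: in_keys_iff)

lemma boundary_add: "boundary (x + y) = boundary x + boundary y"
proof -
  let ?S = "Poly_Mapping.keys x \<union> Poly_Mapping.keys y"
  have "finite ?S" by simp
  note sup = boundary_superset[OF this]
  show ?thesis
    unfolding sup[OF Poly_Mapping.keys_add] sup[OF Un_upper1] sup[OF Un_upper2]
    by (simp add: lookup_add distrib_left single_add sum.distrib)
qed

lemma chain_scale_single: "chain_scale a (Poly_Mapping.single x c) = Poly_Mapping.single x (a * c)"
  by (rule poly_mapping_eqI) (simp add: lookup_single when_def)

lemma chain_scale_sum: "chain_scale a (sum f A) = (\<Sum>x\<in>A. chain_scale a (f x))"
  by (induction A rule: infinite_finite_induct) (simp_all add: chain_scale_laws)

lemma keys_chain_scale: "Poly_Mapping.keys (chain_scale a x) \<subseteq> Poly_Mapping.keys x"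
  by (auto simp: in_keys_iff)

lemma boundary_scale: "boundary (chain_scale a x) = chain_scale a (boundary x)"
  unfolding boundary_superset[OF finite_keys[of x] keys_chain_scale] boundary_def[of x]
  by (simp add: chain_scale_sum chain_scale_single mult.left_commute)

lemma chains_closed:
  "0 \<in> chains K p"
  "x \<in> chains K p \<Longrightarrow> y \<in> chains K p \<Longrightarrow> x + y \<in> chains K p"
  "x \<in> chains K p \<Longrightarrow> chain_scale a x \<in> chains K p"
  unfolding chains_def using Poly_Mapping.keys_add[of x y] keys_chain_scale[of a x] by auto

lemma boundary_zero: "boundary 0 = 0"
  by (simp add: boundary_def)

lemma cycles_closed:
  "0 \<in> cycles K p"
  "x \<in> cycles K p \<Longrightarrow> y \<in> cycles K p \<Longrightarrow> x + y \<in> cycles K p"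
  "x \<in> cycles K p \<Longrightarrow> chain_scale a x \<in> cycles K p"
  unfolding cycles_def
  by (auto simp: chains_closed boundary_add boundary_scale boundary_zero chain_scale_laws)

lemma boundaries_closed:
  "0 \<in> boundaries K p"
  "x \<in> boundaries K p \<Longrightarrow> y \<in> boundaries K p \<Longrightarrow> x + y \<in> boundaries K p"
  "x \<in> boundaries K p \<Longrightarrow> chain_scale a x \<in> boundaries K p"
  unfolding boundaries_def image_iff
  by (metis chains_closed(1) boundary_zero, metis chains_closed(2) boundary_add,
      metis chains_closed(3) boundary_scale)

lemma homology_sel:
  "carrier (homology K p) = homology_class K p ` cycles K p"
  "\<zero>\<^bsub>homology K p\<^esub> = homology_class K p 0"
  by (auto simp: homology_def homology_class_def)

lemma homology_add:
  "homology_class K p x \<oplus>\<^bsub>homology K p\<^esub> homology_class K p y = homology_class K p (x + y)"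
proof (intro Set.set_eqI iffI)
  fix w assume "w \<in> homology_class K p x \<oplus>\<^bsub>homology K p\<^esub> homology_class K p y"
  then obtain b c where "w = (x + b) + (y + c)" "b \<in> boundaries K p" "c \<in> boundaries K p"
    by (auto simp: homology_def homology_class_def)
  then show "w \<in> homology_class K p (x + y)"
    unfolding homology_class_def using boundaries_closed(2)[of b K p c]
    by (auto simp: algebra_simps intro!: exI[of _ "b + c"])
next
  fix w assume "w \<in> homology_class K p (x + y)"
  then obtain b where b: "w = (x + 0) + (y + b)" "b \<in> boundaries K p"
    by (auto simp: homology_class_def add.assoc)
  have "x + 0 \<in> homology_class K p x" "y + b \<in> homology_class K p y"
    using b(2) boundaries_closed(1)[of K p] unfolding homology_class_def by blast+
  with b(1) show "w \<in> homology_class K p x \<oplus>\<^bsub>homology K p\<^esub> homology_class K p y"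
    unfolding homology_def by (simp only: module.select_convs ring.select_convs) blast
qed

lemma homology_smult:
  "a \<odot>\<^bsub>homology K p\<^esub> homology_class K p x = homology_class K p (chain_scale a x)"
proof (intro Set.set_eqI iffI)
  fix w assume "w \<in> a \<odot>\<^bsub>homology K p\<^esub> homology_class K p x"
  then obtain b c where "w = chain_scale a (x + b) + c" "b \<in> boundaries K p" "c \<in> boundaries K p"
    by (auto simp: homology_def homology_class_def)
  then show "w \<in> homology_class K p (chain_scale a x)"
    unfolding homology_class_def
    using boundaries_closed(2)[OF boundaries_closed(3)[of b K p a], of c]
    by (auto simp: chain_scale_laws algebra_simps intro!: exI[of _ "chain_scale a b + c"])
next
  fix w assume "w \<in> homology_class K p (chain_scale a x)"
  then obtain b where b: "w = chain_scale a (x + 0) + b" "b \<in> boundaries K p"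
    by (auto simp: homology_class_def)
  have "x + 0 \<in> homology_class K p x"
    using boundaries_closed(1)[of K p] unfolding homology_class_def by blast
  with b show "w \<in> a \<odot>\<^bsub>homology K p\<^esub> homology_class K p x"
    unfolding homology_def by (simp only: module.select_convs ring.select_convs) blast
qed

lemma vectorspace_homology:
  "vectorspace (class_ring :: 'k::field ring) (homology K p)"
proof (rule vs_criteria)
  show "field (class_ring :: 'k ring)" by (rule class_field)
  show "\<forall>v\<in>carrier (homology K p). \<exists>w\<in>carrier (homology K p). v \<oplus>\<^bsub>homology K p\<^esub> w = \<zero>\<^bsub>homology K p\<^esub>"
  proof
    fix v assume "v \<in> carrier (homology K p)"
    then obtain z where z: "v = homology_class K p z" "z \<in> cycles K p"
      by (auto simp: homology_sel)
    then have "homology_class K p (- z) \<in> carrier (homology K p)"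
      using cycles_closed(3)[of z K p "-1"] by (auto simp: homology_sel chain_scale_laws)
    moreover have "v \<oplus>\<^bsub>homology K p\<^esub> homology_class K p (- z) = \<zero>\<^bsub>homology K p\<^esub>"
      by (simp add: z homology_add homology_sel)
    ultimately show "\<exists>w\<in>carrier (homology K p). v \<oplus>\<^bsub>homology K p\<^esub> w = \<zero>\<^bsub>homology K p\<^esub>"
      by blast
  qed
qed (auto simp: homology_sel homology_add homology_smult cycles_closed chain_scale_laws
       algebra_simps)


section \<open>Pointed compositions\<close>

definition pointed_compositions :: "nat \<Rightarrow> nat list set" where
  "pointed_compositions n = {c. c \<noteq> [] \<and> 0 \<notin> set (butlast c) \<and> sum_list c = n}"

definition comp_type :: "nat list \<Rightarrow> nat multiset \<times> nat" where
  "comp_type c = (mset (butlast c), last c)"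

definition comp_le :: "nat list \<Rightarrow> nat list \<Rightarrow> bool" where
  "comp_le c d \<longleftrightarrow> (\<exists>cs. [] \<notin> set cs \<and> c = concat cs \<and> d = map sum_list cs)"

definition comp_filter :: "nat multiset \<Rightarrow> nat \<Rightarrow> nat \<Rightarrow> nat list set" where
  "comp_filter lam m n = {d \<in> pointed_compositions n.
     \<exists>c \<in> pointed_compositions n. comp_type c = (lam, m) \<and> comp_le c d}"

definition V :: "nat multiset \<Rightarrow> nat \<Rightarrow> nat \<Rightarrow> nat list set" where
  "V lam m n = {d \<in> comp_filter lam m n. last d = m \<and>
     (\<forall>x\<in>set (butlast d). \<exists>S \<subseteq> set_mset lam. x = \<Sum>S)}"

definition W :: "nat multiset \<Rightarrow> nat \<Rightarrow> nat \<Rightarrow> nat list \<Rightarrow> nat list set" where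
  "W lam m n d = {c \<in> V lam m n. comp_le c d \<and> comp_type c = (lam, m)}"

text \<open>For a knapsack partition the list below is unique if it exists.\<close>

definition part_list :: "nat multiset \<Rightarrow> nat \<Rightarrow> nat list" where
  "part_list lam x = (THE xs. sorted_wrt (>) xs \<and> set xs \<subseteq> set_mset lam \<and> sum_list xs = x)"

definition epsilon :: "nat multiset \<Rightarrow> nat list \<Rightarrow> nat list" where
  "epsilon lam d = concat (map (part_list lam) (butlast d)) @ [last d]"

text \<open>The interval $[c_1 + \dots + c_{i-1} + 1, c_1 + \dots + c_i]$, with $i$ counted from \<open>0\<close> on the
  formal side.\<close>

definition row_interval :: "nat list \<Rightarrow> nat \<Rightarrow> nat set" where
  "row_interval c i = {sum_list (take i c)<..sum_list (take (Suc i) c)}"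

text \<open>For a family of disjoint sets, the product of the symmetric groups on its members.\<close>

definition young_subgroup :: "nat set set \<Rightarrow> (nat \<Rightarrow> nat) set" where
  "young_subgroup P = {\<gamma>. \<gamma> permutes \<Union>P \<and> (\<forall>K\<in>P. \<gamma> ` K = K)}"

text \<open>The numbers $t_1, \dots, t_r$ of entries of \<open>epsilon lam d\<close> coming from $d_1, \dots, d_r$.\<close>

definition part_counts :: "nat multiset \<Rightarrow> nat list \<Rightarrow> nat list" where
  "part_counts lam d = map (\<lambda>x. length (part_list lam x)) (butlast d) @ [1]"

text \<open>The sign $(-1)^{\vec c}$ for $\vec c \in W(\vec d)$; the permutation acts on the positions
  $1, 2, \dots$ of the entries. It is unique because the entries of \<open>epsilon lam d\<close> coming from the
  same $d_i$ are distinct; replacing it by its inverse does not change the sign.\<close>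

definition comp_sign :: "nat multiset \<Rightarrow> nat list \<Rightarrow> nat list \<Rightarrow> int" where
  "comp_sign lam d c = sign (THE \<rho>.
     \<rho> \<in> young_subgroup (row_interval (part_counts lam d) ` {..<length d}) \<and>
     (\<forall>j\<in>{1..length c}. c ! (j - 1) = epsilon lam d ! (\<rho> j - 1)))"


section \<open>The cycles\<close>

definition sigma :: "(nat \<Rightarrow> nat) \<Rightarrow> nat list \<Rightarrow> nat set list" where
  "sigma \<alpha> c = map (\<lambda>i. \<alpha> ` row_interval c i) [0..<length c]"

definition descent_set :: "nat \<Rightarrow> (nat \<Rightarrow> nat) \<Rightarrow> nat set" where
  "descent_set n \<alpha> = {j \<in> {1..<n}. \<alpha> j > \<alpha> (j + 1)}"

definition descent_composition :: "nat \<Rightarrow> (nat \<Rightarrow> nat) \<Rightarrow> nat list" where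
  "descent_composition n \<alpha> =
     (let s = sorted_list_of_set (descent_set n \<alpha>) in map2 (-) (s @ [n]) (0 # s))"

definition partial_sums :: "nat list \<Rightarrow> nat set" where
  "partial_sums d = {sum_list (take i d) | i. 1 \<le> i \<and> i < length d}"

text \<open>The last two conjuncts say that the interval cannot be extended to the left or right.\<close>

definition column_intervals :: "nat list \<Rightarrow> nat set set" where
  "column_intervals d = {{a..b} | a b. 1 \<le> a \<and> a \<le> b \<and> b \<le> sum_list d \<and>
     (\<forall>j. a \<le> j \<and> j < b \<longrightarrow> j \<in> partial_sums d) \<and>
     (a = 1 \<or> a - 1 \<notin> partial_sums d) \<and> (b = sum_list d \<or> b \<notin> partial_sums d)}"

definition g_cycle ::
  "nat multiset \<Rightarrow> nat \<Rightarrow> nat \<Rightarrow> (nat \<Rightarrow> nat) \<Rightarrow> nat list \<Rightarrow> (nat set list \<Rightarrow>\<^sub>0 'k::field)" where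
  "g_cycle lam m n \<alpha> d =
     (\<Sum>\<gamma>\<in>young_subgroup (column_intervals d). \<Sum>c\<in>W lam m n d.
        Poly_Mapping.single (sigma (\<alpha> \<circ> \<gamma>) c) (of_int (sign \<gamma> * comp_sign lam d c)))"

end

theory Submission
  imports Defs "HOL-Library.List_Lexorder"
begin

text \<open>$\Lambda_{\{\lambda,\underline m\}}$ has dimension $k - 1$, so the homology in question is the space
  of cycles supported on the facets, the ordered set partitions of type $\{\lambda,\underline m\}$. Order
  the facets lexicographically by the word that lists the blocks one after the other, each increasingly,
  breaking ties by the composition of block sizes. The columns of $\alpha$ are decreasing and the entries
  of $\epsilon(\vec d)$ decrease within each part of $\vec d$, so $\sigma(\alpha,\epsilon(\vec d))$ is the
  largest term of $g_{\alpha,\vec d}$, with coefficient $1$.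

  Conversely, let $C$ be the largest facet in the support of a cycle. If all of $C_i$ is smaller than all
  of $C_{i+1}$ and either $C_{i+1}$ is the pointed block or $|C_i| \le |C_{i+1}|$, then the knapsack
  property shows that every other facet around the face obtained by merging $C_i$ and $C_{i+1}$ is larger
  than $C$, and the boundary cannot vanish at this face. So there is no such $i$, and the facets without
  such an $i$ are exactly the leading terms $\sigma(\alpha,\epsilon(\vec d))$. Triangularity gives both
  linear independence and spanning.\<close>


text \<open>The hypothesis \<open>m > 0\<close> keeps every block of a facet nonempty and every
  entry of \<open>d\<close> positive, so row boundaries grow strictly and \<open>d\<close> can be a
  descent composition. The sizes enter the order because words alone do not separate the terms: the
  descents of \<alpha> lie only at the ends of rows of \<open>d\<close>, so all compositions in
  \<open>W\<close> give the same word for the same \<alpha>. Breaking ties by sizes puts the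
  decreasing arrangement on top. This is also why an ascent is forbidden only if the sizes do not
  decrease: ascents with decreasing sizes are what a row of \<open>d\<close> consists of. An ascent
  into the pointed block is always forbidden, since the size of that block is fixed at
  \<open>m\<close> and cannot be exchanged with its neighbour's. A facet without forbidden ascents
  yields \<open>d\<close> by cutting wherever the ascent fails. In each run the sizes decrease
  strictly, hence are distinct parts, and the knapsack property recovers them from their sum.
  Leading coefficients are exactly 1 and cancellations are pairwise, so the argument is uniform in
  the field.\<close>

section \<open>Lexicographic order and leading terms\<close>

text \<open>In characteristic $2$ the identity \<open>sum F A = - sum F A\<close> says nothing, so the terms have to be
  cancelled in pairs.\<close>

lemma sum_involution_eq_0:
  fixes F :: "'a \<Rightarrow> 'b::ab_group_add"
  assumes "finite A" "\<And>x. x \<in> A \<Longrightarrow> h x \<in> A" "\<And>x. x \<in> A \<Longrightarrow> h (h x) = x"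
    "\<And>x. x \<in> A \<Longrightarrow> h x \<noteq> x" "\<And>x. x \<in> A \<Longrightarrow> F (h x) = - F x"
  shows "sum F A = 0"
  using assms
proof (induction A rule: finite_psubset_induct)
  case (psubset A)
  show ?case
  proof (cases "A = {}")
    case False
    then obtain x where x: "x \<in> A" by blast
    let ?B = "A - {x, h x}"
    have "sum F ?B = 0"
    proof (rule psubset.IH)
      show "?B \<subset> A" using x by blast
      fix y assume y: "y \<in> ?B"
      then have "y \<in> A" by blast
      then show "h y \<in> ?B" using y psubset.prems(1,2) x by (metis Diff_iff insert_iff singleton_iff)
    qed (use psubset.prems in auto)
    moreover have "sum F A = sum F ?B + sum F {x, h x}"
      using psubset.hyps psubset.prems(1) x by (intro sum.subset_diff) auto
    moreover have "sum F {x, h x} = 0"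
      using psubset.prems(4)[OF x] psubset.prems(3)[OF x, THEN not_sym] by simp
    ultimately show ?thesis by simp
  qed simp
qed

section \<open>Lexicographic comparison of lists\<close>

lemma append_le_append:
  fixes xs ys :: "'a::linorder list"
  assumes "length xs = length ys" "xs \<le> ys" "us \<le> vs"
  shows "xs @ us \<le> ys @ vs"
  using assms by (induction xs ys rule: list_induct2) auto

lemma append_less_append:
  fixes xs ys :: "'a::linorder list"
  assumes "length xs = length ys" "xs < ys"
  shows "xs @ us < ys @ vs"
  using assms by (induction xs ys rule: list_induct2) auto

lemma append_less_append_iff:
  fixes us vs :: "'a::linorder list"
  shows "xs @ us < xs @ vs \<longleftrightarrow> us < vs"
  by (induction xs) auto

text \<open>Equal block lengths keep the blocks aligned, so the first strict block decides. This
  compares words block by block in \<open>word_sigma_le\<close> and compositions row by row in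
  \<open>W_le_epsilon\<close>.\<close>

lemma concat_le_concat:
  fixes xss yss :: "'a::linorder list list"
  assumes "list_all2 (\<lambda>xs ys. length xs = length ys \<and> xs \<le> ys) xss yss"
  shows "concat xss \<le> concat yss"
  using assms by (induction rule: list_all2_induct) (auto intro: append_le_append)

lemma sorted_le_of_mset_eq:
  fixes xs ys :: "'a::linorder list"
  assumes "mset xs = mset ys" "sorted xs"
  shows "xs \<le> ys"
  using assms
proof (induction xs arbitrary: ys)
  case (Cons x xs)
  then obtain y ys' where ys: "ys = y # ys'" by (cases ys) auto
  have "y \<in> set (x # xs)" using Cons.prems(1) ys by (metis list.set_intros(1) mset_eq_setD)
  then have "x \<le> y" using Cons.prems(2) by auto
  moreover have "xs \<le> ys'" if "x = y" using Cons that ys by simp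
  ultimately show ?case using ys by auto
qed simp

lemma le_rev_sorted_of_mset_eq:
  fixes xs ys :: "'a::linorder list"
  assumes "mset xs = mset ys" "sorted_wrt (\<ge>) ys"
  shows "xs \<le> ys"
  using assms
proof (induction ys arbitrary: xs)
  case (Cons y ys)
  then obtain x xs' where xs: "xs = x # xs'" by (cases xs) auto
  have "x \<in> set (y # ys)" using Cons.prems(1) xs by (metis list.set_intros(1) mset_eq_setD)
  then have "x \<le> y" using Cons.prems(2) by auto
  moreover have "xs' \<le> ys" if "x = y" using Cons that xs by simp
  ultimately show ?case using xs by auto
qed simp

lemma less_list_of_first_difference:
  fixes xs ys :: "'a::linorder list"
  assumes "p < length xs" "p < length ys" "take p xs = take p ys" "xs ! p < ys ! p"
  shows "xs < ys"
proof -
  have "xs = take p xs @ xs ! p # drop (Suc p) xs" "ys = take p xs @ ys ! p # drop (Suc p) ys"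
    using assms(1-3) by (metis id_take_nth_drop)+
  moreover have "take p xs @ xs ! p # drop (Suc p) xs < take p xs @ ys ! p # drop (Suc p) ys"
    using assms(4) by (simp add: append_less_append_iff)
  ultimately show ?thesis by metis
qed

section \<open>Triangular families of finitely supported functions\<close>

lemma lookup_sum: "Poly_Mapping.lookup (sum f A) x = (\<Sum>a\<in>A. Poly_Mapping.lookup (f a) x)"
  by (induction A rule: infinite_finite_induct) (auto simp: lookup_add)

text \<open>Among the indices with nonzero coefficient take \<open>x\<close> with the largest
  leading key. Its leading term cannot occur in another such \<open>g y\<close>, because
  \<open>lead y\<close> would then have a larger key; so the coefficient of \<open>lead x\<close> in
  the sum is \<open>a x\<close>.\<close>

lemma leading_terms_independent:
  fixes g :: "'i \<Rightarrow> ('b \<Rightarrow>\<^sub>0 'k::field)" and key :: "'b \<Rightarrow> 'o::linorder"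
  assumes "finite I" "inj_on lead I"
    and one: "\<And>x. x \<in> I \<Longrightarrow> Poly_Mapping.lookup (g x) (lead x) = 1"
    and small: "\<And>x C. x \<in> I \<Longrightarrow> C \<in> Poly_Mapping.keys (g x) \<Longrightarrow> C \<noteq> lead x \<Longrightarrow> key C < key (lead x)"
    and zero: "(\<Sum>x\<in>I. chain_scale (a x) (g x)) = 0"
  shows "\<forall>x\<in>I. a x = 0"
proof (rule ccontr)
  assume "\<not> ?thesis"
  then have ne: "{x \<in> I. a x \<noteq> 0} \<noteq> {}" and fin: "finite {x \<in> I. a x \<noteq> 0}" using assms(1) by auto
  define k where "k = Max ((\<lambda>x. key (lead x)) ` {x \<in> I. a x \<noteq> 0})"
  have "k \<in> (\<lambda>x. key (lead x)) ` {x \<in> I. a x \<noteq> 0}"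
    unfolding k_def using ne fin by (intro Max_in) auto
  then obtain x where x: "x \<in> I" "a x \<noteq> 0" "k = key (lead x)" by blast
  have "a y * Poly_Mapping.lookup (g y) (lead x) = 0" if y: "y \<in> I" "y \<noteq> x" for y
  proof (rule ccontr)
    assume *: "\<not> ?thesis"
    then have "lead x \<in> Poly_Mapping.keys (g y)" by (auto simp: in_keys_iff)
    moreover have "lead x \<noteq> lead y" using y x assms(2) by (auto dest: inj_onD)
    ultimately have "key (lead x) < key (lead y)" using small y by blast
    moreover have "key (lead y) \<le> k" unfolding k_def using fin y * by (intro Max_ge) auto
    ultimately show False using x(3) by simp
  qed
  then have "(\<Sum>y\<in>I. a y * Poly_Mapping.lookup (g y) (lead x)) = a x * Poly_Mapping.lookup (g x) (lead x)"
    using assms(1) x(1) by (subst sum.remove[of _ x]) (auto intro!: sum.neutral simp del: mult_eq_0_iff)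
  moreover have "(\<Sum>y\<in>I. a y * Poly_Mapping.lookup (g y) (lead x)) = 0"
    using arg_cong[OF zero, of "\<lambda>z. Poly_Mapping.lookup z (lead x)"] by (simp add: lookup_sum)
  ultimately show False using x one by simp
qed

text \<open>This is elimination from the top: the largest term of \<open>z\<close> is the leading
  term of some generator, and a multiple of that generator removes it. What is special about
  \<open>Z\<close> enters only through \<open>max\<close>.\<close>

lemma leading_terms_span:
  fixes g :: "'i \<Rightarrow> ('b \<Rightarrow>\<^sub>0 'k::field)" and key :: "'b \<Rightarrow> 'o::linorder"
  assumes "finite I" "finite F"
    and one: "\<And>x. x \<in> I \<Longrightarrow> Poly_Mapping.lookup (g x) (lead x) = 1"
    and small: "\<And>x C. x \<in> I \<Longrightarrow> C \<in> Poly_Mapping.keys (g x) \<Longrightarrow> C \<noteq> lead x \<Longrightarrow> key C < key (lead x)"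
    and gZ: "\<And>x. x \<in> I \<Longrightarrow> g x \<in> Z"
    and add: "\<And>x y. x \<in> Z \<Longrightarrow> y \<in> Z \<Longrightarrow> x + y \<in> Z"
    and scale: "\<And>c x. x \<in> Z \<Longrightarrow> chain_scale c x \<in> Z"
    and F: "\<And>z. z \<in> Z \<Longrightarrow> Poly_Mapping.keys z \<subseteq> F"
    and inj: "inj_on key F"
    and max: "\<And>z C. z \<in> Z \<Longrightarrow> C \<in> Poly_Mapping.keys z \<Longrightarrow>
      (\<And>C'. C' \<in> Poly_Mapping.keys z \<Longrightarrow> key C' \<le> key C) \<Longrightarrow> C \<in> lead ` I"
    and z: "z \<in> Z"
  shows "\<exists>a. z = (\<Sum>x\<in>I. chain_scale (a x) (g x))"
  using z
proof (induction "card {C \<in> F. \<exists>C'\<in>Poly_Mapping.keys z. key C \<le> key C'}" arbitrary: z rule: less_induct)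
  case less
  \<comment> \<open>The size of the support would not serve as a measure, since subtracting a
    generator can create new terms. These stay below the old top, so the number of elements of
    \<open>F\<close> at or below the top does drop.\<close>
  let ?below = "\<lambda>z :: 'b \<Rightarrow>\<^sub>0 'k. {C \<in> F. \<exists>C'\<in>Poly_Mapping.keys z. key C \<le> key C'}"
  show ?case
  proof (cases "Poly_Mapping.keys z = {}")
    case True
    then have "z = (\<Sum>x\<in>I. chain_scale 0 (g x))"
      by (intro poly_mapping_eqI) (simp add: lookup_sum)
    then show ?thesis by (rule exI[of _ "\<lambda>_. 0"])
  next
    case False
    have "Max (key ` Poly_Mapping.keys z) \<in> key ` Poly_Mapping.keys z"
      using False by (intro Max_in) auto
    then obtain C where C: "C \<in> Poly_Mapping.keys z" "key C = Max (key ` Poly_Mapping.keys z)" by auto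
    have ge: "key C' \<le> key C" if "C' \<in> Poly_Mapping.keys z" for C'
      unfolding C(2) using that by (intro Max_ge) auto
    obtain x where x: "x \<in> I" "C = lead x" using max[OF less.prems C(1) ge] by blast
    define c where "c = Poly_Mapping.lookup z C"
    define z' where "z' = z + chain_scale (- c) (g x)"
    have z'Z: "z' \<in> Z" unfolding z'_def using less.prems gZ[OF x(1)] add scale by blast
    \<comment> \<open>At \<open>C\<close> itself the coefficient cancels because the leading
      coefficient is 1. Any other term has a key at most \<open>key C\<close>, and injectivity of
      \<open>key\<close> on \<open>F\<close> makes this strict.\<close>
    have lt: "key C' < key C" if C': "C' \<in> Poly_Mapping.keys z'" for C'
    proof -
      have "C' \<noteq> C"
        using C' one[OF x(1)] x(2) by (auto simp: in_keys_iff z'_def lookup_add c_def)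
      moreover have "C' \<in> Poly_Mapping.keys z \<or> C' \<in> Poly_Mapping.keys (g x)"
        using C' by (auto simp: in_keys_iff z'_def lookup_add)
      moreover have "C' \<in> F" "C \<in> F" using F[OF z'Z] F[OF less.prems] C' C(1) by auto
      ultimately show ?thesis
        using ge[of C'] small[OF x(1), of C'] x(2) inj by (metis inj_onD order_le_less)
    qed
    have "card (?below z') < card (?below z)"
    proof (rule psubset_card_mono)
      show "finite (?below z)" using assms(2) by simp
      have "C \<in> ?below z" using C(1) F[OF less.prems] by blast
      moreover have "C \<notin> ?below z'" using lt by force
      moreover have "?below z' \<subseteq> ?below z"
        using lt C(1) by (blast intro: order.trans[OF _ less_imp_le])
      ultimately show "?below z' \<subset> ?below z"
        by blast
    qed
    then obtain a where a: "z' = (\<Sum>x\<in>I. chain_scale (a x) (g x))" using less.hyps z'Z by blast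
    have "(\<Sum>y\<in>I. chain_scale ((a(x := a x + c)) y) (g y))
      = chain_scale (a x + c) (g x) + (\<Sum>y\<in>I-{x}. chain_scale (a y) (g y))"
      using assms(1) x(1) by (subst sum.remove[of _ x]) auto
    also have "\<dots> = chain_scale c (g x) + z'"
      unfolding a using assms(1) x(1) by (subst (2) sum.remove[of _ x]) (auto simp: chain_scale_laws)
    also have "\<dots> = z"
      unfolding z'_def by (rule poly_mapping_eqI) (simp add: lookup_add)
    finally show ?thesis by metis
  qed
qed

section \<open>Knapsack partitions and refinements\<close>

lemma knapsackD:
  "knapsack_partition lam \<Longrightarrow> A \<subseteq># lam \<Longrightarrow> B \<subseteq># lam \<Longrightarrow> sum_mset A = sum_mset B \<Longrightarrow> A = B"
  unfolding knapsack_partition_def inj_on_def by blast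

lemma strictly_decreasing_distinct: "sorted_wrt (>) (xs::'a::linorder list) \<Longrightarrow> distinct xs"
  by (induction xs) auto

lemma mset_set_subseteq_mset: "S \<subseteq> set_mset A \<Longrightarrow> mset_set S \<subseteq># A"
proof -
  assume "S \<subseteq> set_mset A"
  then have "mset_set S \<subseteq># mset_set (set_mset A)" by (simp add: subset_imp_msubset_mset_set)
  then show ?thesis using mset_set_set_mset_msubset by (rule subset_mset.order_trans)
qed

lemma mset_distinct_subseteq: "distinct xs \<Longrightarrow> set xs \<subseteq> set_mset A \<Longrightarrow> mset xs \<subseteq># A"
  by (metis mset_set_set mset_set_subseteq_mset)

text \<open>A list of distinct parts is a submultiset of \<open>lam\<close>, so the knapsack
  property determines its entries from the sum, and strict decrease determines their order. This
  justifies the definite description in \<open>part_list\<close>.\<close>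

lemma part_list_sum_list:
  assumes "knapsack_partition lam" "sorted_wrt (>) xs" "set xs \<subseteq> set_mset lam"
  shows "part_list lam (sum_list xs) = xs"
  unfolding part_list_def
proof (rule the_equality)
  fix ys assume ys: "sorted_wrt (>) ys \<and> set ys \<subseteq> set_mset lam \<and> sum_list ys = sum_list xs"
  have "mset ys = mset xs"
    using ys assms by (intro knapsackD[OF assms(1)])
      (simp_all add: mset_distinct_subseteq strictly_decreasing_distinct sum_mset_sum_list)
  then have "set (rev ys) = set (rev xs)" by (metis mset_eq_setD set_rev)
  moreover have "sorted_wrt (<) (rev ys)" "sorted_wrt (<) (rev xs)"
    using ys assms(2) by (auto simp: sorted_wrt_rev)
  ultimately have "rev ys = rev xs" by (metis strict_sorted_equal)
  then show "ys = xs" by simp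
qed (use assms in auto)

text \<open>Keeps the grouping by rows that \<open>epsilon\<close> forgets. The pointed entry is a
  row of its own, matching the final 1 in \<open>part_counts\<close>.\<close>

definition blocks :: "nat multiset \<Rightarrow> nat list \<Rightarrow> nat list list" where
  "blocks lam d = map (part_list lam) (butlast d) @ [[last d]]"

lemma epsilon_eq_concat: "epsilon lam d = concat (blocks lam d)"
  by (simp add: epsilon_def blocks_def)

lemma part_counts_eq: "part_counts lam d = map length (blocks lam d)"
  by (simp add: part_counts_def blocks_def)

abbreviation mset_eq :: "'a list \<Rightarrow> 'a list \<Rightarrow> bool" where
  "mset_eq xs ys \<equiv> mset xs = mset ys"

lemma mset_subseteq_concat: "x \<in> set cs \<Longrightarrow> mset x \<subseteq># mset (concat cs)"
  by (induction cs) (auto intro: subset_mset.order_trans)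

text \<open>The last group ends in \<open>m\<close> and also sums to \<open>m\<close>; parts of
  \<open>lam\<close> are positive, so it is \<open>[m]\<close>. Any other group is a submultiset of
  \<open>lam\<close> with the same sum as a set of distinct parts, and the knapsack property
  identifies the two.\<close>

lemma blocks_of_refinement:
  assumes kn: "knapsack_partition lam" and cs: "[] \<notin> set cs" "cs \<noteq> []"
    and type: "comp_type (concat cs) = (lam, m)"
    and last: "last (map sum_list cs) = m"
    and sums: "\<forall>x\<in>set (butlast (map sum_list cs)). \<exists>S\<subseteq>set_mset lam. x = \<Sum>S"
  shows "list_all2 mset_eq cs (blocks lam (map sum_list cs))"
    and "\<forall>e\<in>set (blocks lam (map sum_list cs)). e \<noteq> [] \<and> sorted_wrt (>) e"
proof -
  obtain cs' l where csl: "cs = cs' @ [l]" using cs(2) by (cases cs rule: rev_cases) auto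
  have l: "l \<noteq> []" using cs csl by auto
  have bl: "mset (concat cs') + mset (butlast l) = lam" "last l = m"
    using type l by (auto simp: comp_type_def csl butlast_append)
  have "sum_list l = m" using last csl by simp
  moreover have l_eq: "butlast l @ [m] = l" using l bl(2) by (metis append_butlast_last_id)
  have "sum_list l = sum_list (butlast l) + m" by (subst l_eq[symmetric]) simp
  ultimately have "sum_list (butlast l) = 0"
    by simp
  then have "set (butlast l) \<subseteq> {0}" by auto
  moreover have "0 \<notin> set (butlast l)" using kn bl(1) by (auto simp: knapsack_partition_def)
  ultimately have "set (butlast l) = {}" by (metis subset_singletonD singletonI)
  then have lm: "l = [m]" using l_eq by simp
  then have lam: "mset (concat cs') = lam" using bl by simp
  have main: "mset x = mset (part_list lam (sum_list x)) \<and> sorted_wrt (>) (part_list lam (sum_list x))"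
    if x: "x \<in> set cs'" for x
  proof -
    obtain S where S: "S \<subseteq> set_mset lam" "sum_list x = \<Sum>S"
      using sums x by (auto simp: csl)
    have fin: "finite S" using S(1) finite_subset by blast
    define s where "s = rev (sorted_list_of_set S)"
    have s: "sorted_wrt (>) s" "set s = S" "distinct s"
      using fin by (auto simp: s_def sorted_wrt_rev)
    have sum_s: "sum_list s = sum_list x"
      using S(2) s by (metis distinct_sum_list_conv_Sum)
    have "part_list lam (sum_list x) = s"
      using part_list_sum_list[OF kn, of s] s S(1) sum_s by simp
    moreover have "mset x = mset s"
      using mset_subseteq_concat[OF x] lam mset_distinct_subseteq[OF s(3)] s(2) S(1) sum_s
      by (intro knapsackD[OF kn]) (auto simp: sum_mset_sum_list)
    ultimately show ?thesis using s by simp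
  qed
  have bm: "blocks lam (map sum_list cs) = map (\<lambda>x. part_list lam (sum_list x)) cs' @ [[m]]"
    by (simp add: blocks_def csl lm)
  show "list_all2 mset_eq cs (blocks lam (map sum_list cs))"
    unfolding bm unfolding csl lm using main
    by (simp add: list_all2_append list_all2_map2 list_all2_same)
  show "\<forall>e\<in>set (blocks lam (map sum_list cs)). e \<noteq> [] \<and> sorted_wrt (>) e"
  proof
    fix e assume "e \<in> set (blocks lam (map sum_list cs))"
    then consider "e = [m]" | x where "x \<in> set cs'" "e = part_list lam (sum_list x)"
      unfolding bm by auto
    then show "e \<noteq> [] \<and> sorted_wrt (>) e"
    proof cases
      case 2
      then show ?thesis using main[OF 2(1)] cs(1) csl
        by (metis Un_iff mset.simps(1) mset_zero_iff set_append)
    qed simp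
  qed
qed

lemma list_all2_mset_eq_sum:
  fixes cs :: "'a::comm_monoid_add list list"
  shows "list_all2 mset_eq cs es \<Longrightarrow> map sum_list cs = map sum_list es"
proof (induction rule: list_all2_induct)
  case (Cons x xs y ys)
  then have "sum_list x = sum_list y" using sum_mset_sum_list[of x] sum_mset_sum_list[of y] by simp
  then show ?case using Cons by simp
qed simp

lemma list_all2_mset_eq_length: "list_all2 mset_eq cs es \<Longrightarrow> map length cs = map length es"
  by (induction rule: list_all2_induct) (auto simp: size_mset[symmetric] simp del: size_mset)

lemma list_all2_mset_eq_concat: "list_all2 mset_eq cs es \<Longrightarrow> mset (concat cs) = mset (concat es)"
  by (induction rule: list_all2_induct) auto

lemma list_all2_mset_eq_last:
  assumes "list_all2 mset_eq cs (es @ [[m]])"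
  obtains cs' where "cs = cs' @ [[m]]" "list_all2 mset_eq cs' es"
  using assms by (auto simp: list_all2_append2 list_all2_Cons2)

lemma comp_type_concat_blocks:
  assumes "list_all2 mset_eq cs (es @ [[m]])" 
  shows "comp_type (concat cs) = (mset (concat es), m)"
  using assms by (elim list_all2_mset_eq_last) (auto simp: comp_type_def butlast_append dest: list_all2_mset_eq_concat)

locale pointed_knapsack =
  fixes lam :: "nat multiset" and m n k :: nat
  assumes pk: "pointed_knapsack_partition lam m n" and m_pos: "m > 0" and k: "size lam = k"
begin

lemma kn: "knapsack_partition lam" and sum_n: "sum_mset lam + m = n"
  using pk by (auto simp: pointed_knapsack_partition_def)

lemma lam_pos: "x \<in># lam \<Longrightarrow> 0 < x"
  using kn by (cases x) (auto simp: knapsack_partition_def)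

lemma n_pos: "0 < n"
  using sum_n m_pos by simp

lemma comp_typeD:
  assumes "comp_type c = (lam, m)" "c \<noteq> []"
  shows "c \<in> pointed_compositions n" "length c = Suc k" "sum_list c = n" "last c = m" "mset c = add_mset m lam"
proof -
  have c: "butlast c @ [m] = c" "mset (butlast c) = lam"
    using assms append_butlast_last_id[of c] by (auto simp: comp_type_def)
  show "last c = m" using assms(1) by (simp add: comp_type_def)
  show m: "mset c = add_mset m lam" by (subst c(1)[symmetric]) (simp add: c(2))
  show s: "sum_list c = n" using sum_n m by (simp add: sum_mset_sum_list[symmetric])
  show "length c = Suc k" using m k by (metis size_add_mset size_mset)
  show "c \<in> pointed_compositions n"
    using s assms(2) c(2) kn by (auto simp: pointed_compositions_def knapsack_partition_def)
qed

lemma comp_type_in_V: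
  assumes "comp_type c = (lam, m)" "c \<noteq> []"
  shows "c \<in> V lam m n"
proof -
  have "comp_le c c" unfolding comp_le_def
    by (rule exI[of _ "map (\<lambda>x. [x]) c"]) (auto simp: o_def)
  moreover have "\<exists>S\<subseteq>set_mset lam. x = \<Sum>S" if "x \<in> set (butlast c)" for x
    using that assms by (intro exI[of _ "{x}"]) (auto simp: comp_type_def)
  ultimately show ?thesis
    using comp_typeD[OF assms] assms by (auto simp: V_def comp_filter_def)
qed

text \<open>Everything is read off from one refinement of \<open>d\<close> of the right type. The
  last fact is the working description of \<open>W\<close>: its members arise by rearranging the
  entries of \<open>epsilon\<close> inside each row of \<open>d\<close>.\<close>

lemma V_facts:
  assumes "d \<in> V lam m n"
  shows "d \<noteq> []" "last d = m" "sum_list d = n" "0 \<notin> set d"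
    "map sum_list (blocks lam d) = d" "\<forall>e\<in>set (blocks lam d). e \<noteq> [] \<and> sorted_wrt (>) e"
    "blocks lam d = map (part_list lam) (butlast d) @ [[m]]"
    "mset (concat (map (part_list lam) (butlast d))) = lam"
    "comp_type (epsilon lam d) = (lam, m)" "epsilon lam d \<noteq> []"
    "\<And>c. c \<in> W lam m n d \<longleftrightarrow> (\<exists>cs. c = concat cs \<and> list_all2 mset_eq cs (blocks lam d))"
proof -
  have d: "d \<in> comp_filter lam m n" "last d = m" "\<forall>x\<in>set (butlast d). \<exists>S\<subseteq>set_mset lam. x = \<Sum>S"
    using assms by (auto simp: V_def)
  then obtain c where c: "d \<in> pointed_compositions n" "c \<in> pointed_compositions n" "comp_type c = (lam, m)" "comp_le c d"
    by (auto simp: comp_filter_def)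
  show ne: "d \<noteq> []" and "last d = m" and "sum_list d = n" using c d by (auto simp: pointed_compositions_def)
  \<comment> \<open>Only the last entry could be 0, and it equals \<open>m\<close>.\<close>
  show "0 \<notin> set d"
  proof -
    have "butlast d @ [m] = d" using ne d(2) by (metis append_butlast_last_id)
    moreover have "0 \<notin> set (butlast d @ [m])" using c(1) m_pos by (auto simp: pointed_compositions_def)
    ultimately show ?thesis by simp
  qed
  have ref: "list_all2 mset_eq cs (blocks lam d)" "\<forall>e\<in>set (blocks lam d). e \<noteq> [] \<and> sorted_wrt (>) e"
    if "comp_type (concat cs) = (lam, m)" "[] \<notin> set cs" "d = map sum_list cs" for cs
    using blocks_of_refinement[OF kn that(2) _ that(1)] d(2,3) that(3) ne by auto
  obtain cs where cs: "c = concat cs" "[] \<notin> set cs" "d = map sum_list cs" using c(4) by (auto simp: comp_le_def)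
  have cs2: "list_all2 mset_eq cs (blocks lam d)"
    using ref(1)[of cs] c(3) cs by simp
  show "map sum_list (blocks lam d) = d" using list_all2_mset_eq_sum[OF cs2] cs(3) by simp
  show nes: "\<forall>e\<in>set (blocks lam d). e \<noteq> [] \<and> sorted_wrt (>) e" using ref(2)[of cs] c(3) cs by simp
  show bl: "blocks lam d = map (part_list lam) (butlast d) @ [[m]]" using d(2) by (simp add: blocks_def)
  show lam: "mset (concat (map (part_list lam) (butlast d))) = lam"
    using comp_type_concat_blocks[OF cs2[unfolded bl]] c(3) cs(1) by simp
  have ty: "comp_type (concat cs) = (lam, m)" if "list_all2 mset_eq cs (blocks lam d)" for cs
    using comp_type_concat_blocks[OF that[unfolded bl]] lam by simp
  show "comp_type (epsilon lam d) = (lam, m)"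
    unfolding epsilon_eq_concat by (rule ty) (simp add: list_all2_refl)
  show "epsilon lam d \<noteq> []" by (simp add: epsilon_def)
  show "c \<in> W lam m n d \<longleftrightarrow> (\<exists>cs. c = concat cs \<and> list_all2 mset_eq cs (blocks lam d))" for c
  proof
    assume "c \<in> W lam m n d"
    then show "\<exists>cs. c = concat cs \<and> list_all2 mset_eq cs (blocks lam d)"
      using ref(1) by (auto simp: W_def comp_le_def)
  next
    assume "\<exists>cs. c = concat cs \<and> list_all2 mset_eq cs (blocks lam d)"
    then obtain cs where cs: "c = concat cs" "list_all2 mset_eq cs (blocks lam d)" by blast
    have "[] \<notin> set cs"
    proof
      assume "[] \<in> set cs"
      then obtain i where "i < length cs" "cs ! i = []" by (auto simp: in_set_conv_nth)
      then have "blocks lam d ! i = []" "i < length (blocks lam d)" using cs(2) by (auto simp: list_all2_conv_all_nth)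
      then show False using nes nth_mem by blast
    qed
    moreover have "map sum_list cs = d"
      using list_all2_mset_eq_sum[OF cs(2)] \<open>map sum_list (blocks lam d) = d\<close> by simp
    moreover have "c \<noteq> []" using cs bl by (auto elim: list_all2_mset_eq_last)
    ultimately show "c \<in> W lam m n d"
      using comp_type_in_V[of c] ty[OF cs(2)] cs(1) by (auto simp: W_def comp_le_def)
  qed
qed

end

section \<open>Row intervals and the signs of compositions\<close>

abbreviation psum :: "nat list \<Rightarrow> nat \<Rightarrow> nat" where
  "psum c i \<equiv> sum_list (take i c)"

lemma psum_Suc: "i < length c \<Longrightarrow> psum c (Suc i) = psum c i + c ! i"
  by (simp add: take_Suc_conv_app_nth)

lemma psum_mono: "i \<le> j \<Longrightarrow> psum c i \<le> psum c j"
proof -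
  assume "i \<le> j"
  then have "take j c = take i c @ take (j - i) (drop i c)" by (metis le_add_diff_inverse take_add)
  then show ?thesis by simp
qed

text \<open>Row intervals as lists, so that one-line words split as concatenations along the
  rows.\<close>

definition row_list :: "nat list \<Rightarrow> nat \<Rightarrow> nat list" where
  "row_list c i = [Suc (psum c i)..<Suc (psum c (Suc i))]"

lemma set_row_list: "set (row_list c i) = row_interval c i"
  by (auto simp: row_list_def row_interval_def)

lemma length_row_list: "i < length c \<Longrightarrow> length (row_list c i) = c ! i"
  by (simp add: row_list_def psum_Suc)

lemma concat_row_list: "concat (map (row_list c) [0..<length c]) = [1..<Suc (sum_list c)]"
proof -
  have "concat (map (row_list c) [0..<N]) = [1..<Suc (psum c N)]" if "N \<le> length c" for N
    using that
  proof (induction N)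
    case (Suc N)
    have "[1..<Suc (psum c (Suc N))] = [1..<Suc (psum c N)] @ [Suc (psum c N)..<Suc (psum c (Suc N))]"
      using psum_mono[of N "Suc N" c] upt_add_eq_append[of 1 "Suc (psum c N)" "psum c (Suc N) - psum c N"]
      by simp
    then show ?case using Suc by (simp add: row_list_def)
  qed simp
  from this[of "length c"] show ?thesis by simp
qed

lemma UN_row_interval: "(\<Union>i<length c. row_interval c i) = {1..sum_list c}"
proof -
  have "(\<Union>i<length c. row_interval c i) = set (concat (map (row_list c) [0..<length c]))"
    by (auto simp: set_row_list)
  also have "\<dots> = {1..sum_list c}" unfolding concat_row_list by auto
  finally show ?thesis .
qed

lemma row_interval_unique: "x \<in> row_interval c i \<Longrightarrow> x \<in> row_interval c j \<Longrightarrow> i = j"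
  using psum_mono[of "Suc i" j c] psum_mono[of "Suc j" i c]
  by (cases i j rule: linorder_cases) (auto simp: row_interval_def)

lemma row_interval_Suc_iff:
  assumes "x \<notin> partial_sums c" "1 \<le> x" "Suc x \<le> sum_list c" "i < length c"
  shows "x \<in> row_interval c i \<longleftrightarrow> Suc x \<in> row_interval c i"
proof -
  \<comment> \<open>The total is not among the \<open>partial_sums\<close>; it is ruled out by the
    bound \<open>Suc x \<le> sum_list c\<close>.\<close>
  have "psum c (Suc i) \<noteq> x"
  proof
    assume x: "psum c (Suc i) = x"
    then have "Suc i < length c" using assms(3,4) by (cases "Suc i = length c") auto
    then show False using x assms(1) unfolding partial_sums_def by force
  qed
  moreover have "psum c i \<noteq> x"
  proof
    assume x: "psum c i = x"
    then have "1 \<le> i" using assms(2) by (cases i) auto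
    then show False using x assms(1,4) unfolding partial_sums_def by force
  qed
  ultimately show ?thesis by (auto simp: row_interval_def)
qed

lemma partial_sum_not_in_row:
  assumes "x \<in> partial_sums c" "x \<in> row_interval c i"
  shows "Suc x \<notin> row_interval c i"
proof
  assume "Suc x \<in> row_interval c i"
  obtain r where "x = psum c r" using assms(1) by (auto simp: partial_sums_def)
  then show False using assms(2) \<open>Suc x \<in> row_interval c i\<close> psum_mono[of r i c] psum_mono[of "Suc i" r c]
    by (cases "r \<le> i") (auto simp: row_interval_def)
qed

section \<open>Young subgroups and rearrangements inside blocks\<close>

lemma young_subgroup_id: "id \<in> young_subgroup P"
  by (simp add: young_subgroup_def permutes_id)

lemma finite_young_subgroup: "finite (\<Union>P) \<Longrightarrow> finite (young_subgroup P)"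
  unfolding young_subgroup_def using finite_permutations[of "\<Union>P"] by (rule rev_finite_subset) auto

text \<open>Supplies the sign-reversing involutions for both groups: two adjacent positions in the
  same row, or in the same column, may be exchanged.\<close>

lemma young_subgroup_transpose:
  assumes "\<gamma> \<in> young_subgroup P" "a \<in> \<Union>P" "b \<in> \<Union>P" "\<And>K. K \<in> P \<Longrightarrow> a \<in> K \<longleftrightarrow> b \<in> K"
  shows "\<gamma> \<circ> transpose a b \<in> young_subgroup P"
proof -
  have "transpose a b ` K = K" if "K \<in> P" for K
    using assms(4)[OF that] by (auto simp: transpose_def image_iff)
  then have "(\<gamma> \<circ> transpose a b) ` K = K" if "K \<in> P" for K
    using that assms(1) by (metis (mono_tags, lifting) image_comp mem_Collect_eq young_subgroup_def)
  then show ?thesis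
    using assms(1) permutes_compose[OF permutes_swap_id[OF assms(2,3)], of \<gamma>]
    by (simp add: young_subgroup_def del: image_comp comp_apply)
qed

lemma sign_comp_transpose:
  assumes "\<gamma> permutes S" "finite S" "a \<noteq> b"
  shows "sign (\<gamma> \<circ> transpose a b) = - sign \<gamma>"
proof -
  have "permutation \<gamma>" using assms permutation_permutes by blast
  then show ?thesis using assms(3) by (simp add: sign_compose permutation_swap_id sign_swap_id)
qed

lemma comp_transpose_neq: 
  assumes "\<gamma> permutes S" "a \<noteq> b"
  shows "\<gamma> \<circ> transpose a b \<noteq> \<gamma>"
proof
  assume "\<gamma> \<circ> transpose a b = \<gamma>"
  then have "\<gamma> b = \<gamma> a" by (metis comp_apply transpose_apply_first)
  then show False using assms by (metis permutes_inverses(2))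
qed

lemma nth_block:
  assumes "i < length es"
  shows "es ! i = map (\<lambda>j. concat es ! (j - 1)) (row_list (map length es) i)"
proof -
  have len: "psum (map length es) i = length (concat (take i es))"
    by (simp add: length_concat take_map)
  have len': "psum (map length es) (Suc i) = length (concat (take i es)) + length (es ! i)"
    using assms by (simp add: psum_Suc len)
  have c: "concat es = concat (take i es) @ es ! i @ concat (drop (Suc i) es)"
    using assms by (metis concat.simps(2) concat_append id_take_nth_drop)
  show ?thesis
  proof (rule nth_equalityI)
    fix j assume "j < length (es ! i)"
    then show "es ! i ! j = map (\<lambda>j. concat es ! (j - 1)) (row_list (map length es) i) ! j"
      unfolding row_list_def len len' c by (simp add: nth_append del: upt_Suc)
  qed (simp add: row_list_def len len' del: upt_Suc)
qed

text \<open>Follows the equation that defines the permutation in \<open>comp_sign\<close>, with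
  one-based positions. Composing \<rho> on the right with a transposition exchanges the two entries
  at these positions of the resulting list.\<close>

definition permuted :: "nat list \<Rightarrow> (nat \<Rightarrow> nat) \<Rightarrow> nat list" where
  "permuted E \<rho> = map (\<lambda>j. E ! (\<rho> j - 1)) [1..<Suc (length E)]"

lemma length_permuted [simp]: "length (permuted E \<rho>) = length E"
  by (simp add: permuted_def del: upt_Suc)

lemma nth_permuted: "i < length E \<Longrightarrow> permuted E \<rho> ! i = E ! (\<rho> (Suc i) - 1)"
  by (simp add: permuted_def del: upt_Suc)

lemma permuted_id: "permuted E id = E"
  by (rule nth_equalityI) (auto simp: nth_permuted)

abbreviation row_intervals :: "nat list \<Rightarrow> nat set set" where
  "row_intervals t \<equiv> row_interval t ` {..<length t}"

lemma Union_rows: "\<Union>(row_intervals t) = {1..sum_list t}"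
  using UN_row_interval[of t] by simp

lemma permuted_blocks:
  assumes "\<rho> \<in> young_subgroup (row_intervals (map length es))"
  shows "\<exists>cs. permuted (concat es) \<rho> = concat cs \<and> list_all2 mset_eq cs es"
proof -
  let ?t = "map length es"
  define cs where "cs = map (\<lambda>i. map (\<lambda>j. concat es ! (\<rho> j - 1)) (row_list ?t i)) [0..<length es]"
  have "concat cs = map (\<lambda>j. concat es ! (\<rho> j - 1)) (concat (map (row_list ?t) [0..<length ?t]))"
    by (simp add: cs_def map_concat o_def)
  then have "permuted (concat es) \<rho> = concat cs"
    unfolding concat_row_list permuted_def by (simp add: length_concat del: upt_Suc)
  moreover have "list_all2 mset_eq cs es"
  proof (rule list_all2_all_nthI)
    fix i assume "i < length cs"
    then have i: "i < length es" by (simp add: cs_def)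
    have R: "\<rho> ` row_interval ?t i = row_interval ?t i" and inj: "inj_on \<rho> (row_interval ?t i)"
      using assms i permutes_inj_on by (auto simp: young_subgroup_def)
    have dist: "mset (row_list ?t i) = mset_set (row_interval ?t i)"
      by (metis distinct_upt mset_set_set row_list_def set_row_list)
    have "mset (es ! i) = image_mset (\<lambda>j. concat es ! (j - 1)) (mset_set (row_interval ?t i))"
      by (subst nth_block[OF i]) (simp add: dist)
    also have "\<dots> = image_mset (\<lambda>j. concat es ! (j - 1)) (image_mset \<rho> (mset_set (row_interval ?t i)))"
      by (simp add: image_mset_mset_set[OF inj] R)
    also have "\<dots> = mset (cs ! i)"
      using i by (simp add: cs_def dist image_mset.compositionality o_def)
    finally show "mset_eq (cs ! i) (es ! i)" ..
  qed (simp add: cs_def)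
  ultimately show ?thesis by blast
qed

text \<open>Converse of \<open>permuted_blocks\<close>: each block has its own rearrangement, and
  these are transported to the row intervals and glued, which is possible because the intervals are
  disjoint.\<close>

lemma blocks_permuted:
  assumes "list_all2 mset_eq cs es"
  shows "\<exists>\<rho>\<in>young_subgroup (row_intervals (map length es)). concat cs = permuted (concat es) \<rho>"
proof -
  let ?t = "map length es"
  have t: "map length cs = ?t" using list_all2_mset_eq_length[OF assms] .
  have len: "length cs = length es" using assms by (rule list_all2_lengthD)
  have "\<exists>p. p permutes row_interval ?t i \<and> (\<forall>j\<in>row_interval ?t i. concat cs ! (j - 1) = concat es ! (p j - 1))"
    if i: "i < length es" for i
  proof -
    let ?r = "row_list ?t i" 
    have "mset (cs ! i) = mset (es ! i)" using assms i by (auto simp: list_all2_conv_all_nth)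
    then obtain q where q: "q permutes {..<length (es ! i)}" "permute_list q (es ! i) = cs ! i"
      by (rule mset_eq_permutation)
    have lr: "length ?r = length (es ! i)" using i by (simp add: length_row_list)
    have bij: "bij_betw ((!) ?r) {..<length (es ! i)} (row_interval ?t i)"
      by (rule bij_betw_nth) (simp_all add: lr set_row_list, simp add: row_list_def)
    \<comment> \<open>\<open>f\<close> numbers the row interval from 0 and \<open>g\<close> is its
      inverse, so \<open>p\<close> is \<open>q\<close> carried from positions inside the block to
      positions in the concatenation.\<close>
    define f where "f = (!) ?r"
    define g where "g = the_inv_into {..<length (es ! i)} f"
    define p where "p = (\<lambda>j. if j \<in> row_interval ?t i then f (q (g j)) else j)"
    have bg: "bij_betw g (row_interval ?t i) {..<length (es ! i)}"
      unfolding g_def f_def using bij by (rule bij_betw_the_inv_into)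
    have "bij_betw (\<lambda>j. f (q (g j))) (row_interval ?t i) (row_interval ?t i)"
      using bij_betw_trans[OF bij_betw_trans[OF bg permutes_imp_bij[OF q(1)]] bij]
      by (simp add: f_def o_def)
    then have "bij_betw p (row_interval ?t i) (row_interval ?t i)"
      by (rule bij_betw_cong[THEN iffD1, rotated]) (simp add: p_def)
    then have "p permutes row_interval ?t i"
      by (rule bij_imp_permutes) (simp add: p_def)
    moreover have "concat cs ! (j - 1) = concat es ! (p j - 1)" if j: "j \<in> row_interval ?t i" for j
    proof -
      have fg: "f (g j) = j"
        unfolding g_def f_def using bij j by (intro f_the_inv_into_f) (auto simp: bij_betw_def)
      have gj: "g j < length (es ! i)" using bg j by (auto simp: bij_betw_def)
      have qg: "q (g j) < length (es ! i)" using permutes_in_image[OF q(1), of "g j"] gj by simp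
      have "concat cs ! (j - 1) = cs ! i ! g j"
        using i gj len lr fg by (subst nth_block[of i cs]) (simp_all add: t f_def)
      also have "\<dots> = es ! i ! q (g j)" using q gj permute_list_nth by metis
      also have "\<dots> = concat es ! (p j - 1)"
        using i qg j lr by (subst nth_block[of i es]) (simp_all add: p_def f_def)
      finally show ?thesis .
    qed
    ultimately show ?thesis by blast
  qed
  then obtain p where p: "\<And>i. i < length es \<Longrightarrow> p i permutes row_interval ?t i"
    "\<And>i j. i < length es \<Longrightarrow> j \<in> row_interval ?t i \<Longrightarrow> concat cs ! (j - 1) = concat es ! (p i j - 1)"
    by metis
  define N where "N = sum_list ?t"
  \<comment> \<open>The row containing \<open>j\<close>, which picks the local permutation that
    \<rho> uses at \<open>j\<close>.\<close>
  define idx where "idx j = (THE i. i < length es \<and> j \<in> row_interval ?t i)" for j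
  have idx: "idx j = i" if "i < length es" "j \<in> row_interval ?t i" for i j
    unfolding idx_def using that row_interval_unique by (intro the_equality) auto
  have cover: "\<exists>i<length es. j \<in> row_interval ?t i" if "j \<in> {1..N}" for j
    using that UN_row_interval[of ?t] unfolding N_def by auto
  define \<rho> where "\<rho> j = (if j \<in> {1..N} then p (idx j) j else j)" for j
  have sub: "row_interval ?t i \<subseteq> {1..N}" if "i < length es" for i
    using that UN_row_interval[of ?t] unfolding N_def by auto
  have \<rho>: "\<rho> j = p i j" if "i < length es" "j \<in> row_interval ?t i" for i j
    using that subsetD[OF sub[OF that(1)] that(2)] idx[OF that] by (simp add: \<rho>_def)
  have R: "\<rho> ` row_interval ?t i = row_interval ?t i" if "i < length es" for i
    using \<rho>[OF that] permutes_image[OF p(1)[OF that]] by (metis image_cong)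
  have "\<rho> permutes {1..N}"
  proof (rule bij_imp_permutes)
    have "\<rho> ` {1..N} = {1..N}"
    proof -
      have "\<rho> ` {1..N} = (\<Union>i<length es. \<rho> ` row_interval ?t i)"
        using UN_row_interval[of ?t] unfolding N_def by (metis image_UN length_map)
      also have "\<dots> = {1..N}" using R UN_row_interval[of ?t] unfolding N_def by simp
      finally show ?thesis .
    qed
    then show "bij_betw \<rho> {1..N} {1..N}"
      by (simp add: bij_betw_def eq_card_imp_inj_on)
  qed (auto simp: \<rho>_def)
  then have "\<rho> \<in> young_subgroup (row_intervals ?t)"
    using R Union_rows[of ?t] by (auto simp: young_subgroup_def N_def)
  moreover have "concat cs = permuted (concat es) \<rho>"
  proof (rule nth_equalityI)
    show l: "length (concat cs) = length (permuted (concat es) \<rho>)"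
      using t by (simp add: length_concat)
    fix a assume a: "a < length (concat cs)"
    then have "Suc a \<in> {1..N}" using t by (simp add: N_def length_concat)
    then obtain i where i: "i < length es" "Suc a \<in> row_interval ?t i" using cover by blast
    show "concat cs ! a = permuted (concat es) \<rho> ! a"
      using p(2)[OF i] \<rho>[OF i] a l by (simp add: nth_permuted)
  qed
  ultimately show ?thesis by blast
qed

text \<open>Both permutations send \<open>j\<close> into the row of \<open>j\<close>, and within a
  row the entries are distinct, so the entry found there determines the position.\<close>

lemma permuted_inj:
  assumes "\<rho> \<in> young_subgroup (row_intervals (map length es))" "\<rho>' \<in> young_subgroup (row_intervals (map length es))"
    "\<forall>e\<in>set es. distinct e"
    "\<forall>j\<in>{1..length (concat es)}. concat es ! (\<rho> j - 1) = concat es ! (\<rho>' j - 1)"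
  shows "\<rho> = \<rho>'"
proof
  fix j
  let ?t = "map length es"
  have N: "sum_list ?t = length (concat es)" by (simp add: length_concat)
  show "\<rho> j = \<rho>' j"
  proof (cases "j \<in> {1..length (concat es)}")
    case True
    then have "j \<in> (\<Union>i<length ?t. row_interval ?t i)" unfolding UN_row_interval N .
    then obtain i where i: "i < length es" "j \<in> row_interval ?t i" by auto
    have "\<rho> ` row_interval ?t i = row_interval ?t i" "\<rho>' ` row_interval ?t i = row_interval ?t i"
      using assms(1,2) i(1) by (auto simp: young_subgroup_def)
    then have R: "\<rho> j \<in> set (row_list ?t i)" "\<rho>' j \<in> set (row_list ?t i)"
      using i(2) unfolding set_row_list by blast+
    have "distinct (es ! i)" using assms(3) i by simp
    then have "inj_on (\<lambda>j. concat es ! (j - 1)) (set (row_list ?t i))"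
      using nth_block[OF i(1)] by (metis distinct_map)
    then show ?thesis using R assms(4) True by (auto dest: inj_onD)
  next
    case False
    then show ?thesis using assms(1,2) Union_rows[of ?t] unfolding N young_subgroup_def
      by (metis (no_types, lifting) mem_Collect_eq permutes_not_in)
  qed
qed

context pointed_knapsack
begin

text \<open>This group acts on the \<open>k + 1\<close> positions of parts in a composition, whereas
  \<open>column_group\<close> acts on the \<open>n\<close> positions of a word.\<close>

abbreviation row_group :: "nat list \<Rightarrow> (nat \<Rightarrow> nat) set" where
  "row_group d \<equiv> young_subgroup (row_intervals (part_counts lam d))"

lemma blocks_distinct: "d \<in> V lam m n \<Longrightarrow> \<forall>e\<in>set (blocks lam d). distinct e"
  using V_facts(6) strictly_decreasing_distinct by blast

text \<open>Turns the sum over \<open>W\<close> into a sum over a group with its ordinary sign, so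
  that row and column operations can be cancelled by the same kind of involution. Uniqueness of
  \<rho>, which \<open>comp_sign\<close> relies on, comes from \<open>permuted_inj\<close>.\<close>

lemma W_eq_permuted:
  assumes "d \<in> V lam m n"
  shows "W lam m n d = permuted (epsilon lam d) ` row_group d"
    and "inj_on (permuted (epsilon lam d)) (row_group d)"
    and "\<rho> \<in> row_group d \<Longrightarrow> comp_sign lam d (permuted (epsilon lam d) \<rho>) = sign \<rho>"
proof -
  note eq = epsilon_eq_concat part_counts_eq
  show "W lam m n d = permuted (epsilon lam d) ` row_group d"
  proof (intro Set.set_eqI iffI)
    fix c assume "c \<in> W lam m n d"
    then obtain cs where "c = concat cs" "list_all2 mset_eq cs (blocks lam d)" using V_facts(11)[OF assms] by blast
    then show "c \<in> permuted (epsilon lam d) ` row_group d"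
      using blocks_permuted[of cs "blocks lam d"] unfolding eq by (auto simp: image_iff)
  next
    fix c assume "c \<in> permuted (epsilon lam d) ` row_group d"
    then show "c \<in> W lam m n d"
      using V_facts(11)[OF assms] permuted_blocks[of _ "blocks lam d"] unfolding eq by blast
  qed
  show "inj_on (permuted (epsilon lam d)) (row_group d)"
  proof (rule inj_onI)
    fix \<rho> \<rho>' assume *: "\<rho> \<in> row_group d" "\<rho>' \<in> row_group d" "permuted (epsilon lam d) \<rho> = permuted (epsilon lam d) \<rho>'"
    show "\<rho> = \<rho>'"
      using *(1,2) blocks_distinct[OF assms] unfolding eq
    proof (rule permuted_inj)
      show "\<forall>j\<in>{1..length (concat (blocks lam d))}.
         concat (blocks lam d) ! (\<rho> j - 1) = concat (blocks lam d) ! (\<rho>' j - 1)"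
        using *(3) unfolding eq permuted_def map_eq_conv by auto
    qed
  qed
  show "comp_sign lam d (permuted (epsilon lam d) \<rho>) = sign \<rho>" if \<rho>: "\<rho> \<in> row_group d"
  proof -
    have len: "length d = length (part_counts lam d)"
      using V_facts(1)[OF assms] by (simp add: part_counts_def)
    have "(THE \<rho>'. \<rho>' \<in> row_group d \<and> (\<forall>j\<in>{1..length (permuted (epsilon lam d) \<rho>)}.
        permuted (epsilon lam d) \<rho> ! (j - 1) = epsilon lam d ! (\<rho>' j - 1))) = \<rho>"
    proof (rule the_equality)
      show "\<rho> \<in> row_group d \<and> (\<forall>j\<in>{1..length (permuted (epsilon lam d) \<rho>)}.
        permuted (epsilon lam d) \<rho> ! (j - 1) = epsilon lam d ! (\<rho> j - 1))"
        using \<rho> by (auto simp: nth_permuted)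
      fix \<rho>' assume *: "\<rho>' \<in> row_group d \<and> (\<forall>j\<in>{1..length (permuted (epsilon lam d) \<rho>)}.
        permuted (epsilon lam d) \<rho> ! (j - 1) = epsilon lam d ! (\<rho>' j - 1))"
      show "\<rho>' = \<rho>"
      proof (rule permuted_inj[of _ "blocks lam d"])
        show "\<forall>e\<in>set (blocks lam d). distinct e" using blocks_distinct[OF assms] .
        show "\<forall>j\<in>{1..length (concat (blocks lam d))}.
          concat (blocks lam d) ! (\<rho>' j - 1) = concat (blocks lam d) ! (\<rho> j - 1)"
        proof
          fix j assume j: "j \<in> {1..length (concat (blocks lam d))}"
          then have "permuted (epsilon lam d) \<rho> ! (j - 1) = epsilon lam d ! (\<rho>' j - 1)"
            using * unfolding eq by simp
          moreover have "permuted (epsilon lam d) \<rho> ! (j - 1) = epsilon lam d ! (\<rho> j - 1)"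
            using j unfolding eq by (auto simp: nth_permuted)
          ultimately show "concat (blocks lam d) ! (\<rho>' j - 1) = concat (blocks lam d) ! (\<rho> j - 1)"
            by (simp add: eq)
        qed
      qed (use * \<rho> in \<open>auto simp: eq\<close>)
    qed
    then show ?thesis unfolding comp_sign_def len by simp
  qed
qed

end

section \<open>Column intervals and the boundary of the cycles\<close>

lemma sum_list_concat: "sum_list (concat xss) = sum_list (map sum_list xss)"
  by (induction xss) auto

lemma psum_strict_mono:
  assumes "0 \<notin> set c" "i < j" "j \<le> length c"
  shows "psum c i < psum c j"
proof -
  have "psum c i < psum c (Suc i)"
    using assms psum_Suc[of i c] nth_mem[of i c] by (metis less_add_same_cancel1 not_gr_zero order_less_le_trans)
  also have "\<dots> \<le> psum c j" using assms(2) by (intro psum_mono) simp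
  finally show ?thesis .
qed

lemma partial_sums_bounds:
  assumes "0 \<notin> set d"
  shows "partial_sums d \<subseteq> {1..<sum_list d}"
proof
  fix x assume "x \<in> partial_sums d"
  then obtain i where i: "x = psum d i" "1 \<le> i" "i < length d" by (auto simp: partial_sums_def)
  then show "x \<in> {1..<sum_list d}"
    using psum_strict_mono[OF assms, of 0 i] psum_strict_mono[OF assms, of i "length d"] by simp
qed

lemma partial_sums_eq_image: "partial_sums d = psum d ` {1..<length d}"
  by (auto simp: partial_sums_def)

section \<open>Descent compositions and their partial sums\<close>

lemma descent_composition_partial_sums:
  assumes "0 < n"
  shows "partial_sums (descent_composition n \<alpha>) = descent_set n \<alpha>"
proof -
  define s where "s = sorted_list_of_set (descent_set n \<alpha>)"
  define d where "d = descent_composition n \<alpha>"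
  have fin: "finite (descent_set n \<alpha>)" by (simp add: descent_set_def)
  have s: "sorted_wrt (<) s" "set s = descent_set n \<alpha>" using fin by (auto simp: s_def)
  have d: "d = map2 (-) (s @ [n]) (0 # s)" by (simp add: d_def descent_composition_def s_def Let_def)
  have len: "length d = Suc (length s)" by (simp add: d)
  \<comment> \<open>Strict growth makes the truncated differences genuine, so the partial sums of
    \<open>d\<close> telescope back to the descents. If there are no descents, this is where
    \<open>0 < n\<close> is used.\<close>
  have sn: "sorted_wrt (<) (0 # s @ [n])"
    using s assms by (auto simp: sorted_wrt_append descent_set_def)
  have ps: "psum d i = (0 # s @ [n]) ! i" if "i \<le> length d" for i
    using that
  proof (induction i)
    case (Suc i)
    have "d ! i = (s @ [n]) ! i - (0 # s) ! i"
      using Suc.prems len by (simp add: d)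
    moreover have "(0 # s) ! i = (0 # s @ [n]) ! i"
      using Suc.prems len by (cases i) (auto simp: nth_append)
    moreover have "(0 # s @ [n]) ! i < (0 # s @ [n]) ! Suc i"
      using Suc.prems len sorted_wrt_nth_less[OF sn, of i "Suc i"] by simp
    ultimately show ?case using Suc psum_Suc[of i d] len by simp
  qed simp
  have "partial_sums d = (\<lambda>i. psum d (Suc i)) ` {..<length s}"
  proof (intro equalityI subsetI)
    fix x assume "x \<in> partial_sums d"
    then obtain i where i: "x = psum d i" "1 \<le> i" "i < length d" by (auto simp: partial_sums_def)
    then have "x = psum d (Suc (i - 1))" "i - 1 \<in> {..<length s}" using len by auto
    then show "x \<in> (\<lambda>i. psum d (Suc i)) ` {..<length s}" by blast
  next
    fix x assume "x \<in> (\<lambda>i. psum d (Suc i)) ` {..<length s}"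
    then obtain i where "x = psum d (Suc i)" "i < length s" by blast
    then show "x \<in> partial_sums d" unfolding partial_sums_def using len
      by (intro CollectI exI[of _ "Suc i"]) simp
  qed
  also have "\<dots> = (!) s ` {..<length s}"
    by (intro image_cong) (use ps len in \<open>auto simp: nth_append\<close>)
  also have "\<dots> = set s" by (auto simp: set_conv_nth)
  finally show ?thesis using s d_def by simp
qed

text \<open>Positive entries make the partial sums strictly increasing, so the sorted descent set
  lists them in their original order and consecutive differences return \<open>d\<close>.\<close>

lemma descent_composition_eqI:
  assumes "d \<noteq> []" "0 \<notin> set d" "partial_sums d = descent_set n \<alpha>" "sum_list d = n"
  shows "descent_composition n \<alpha> = d"
proof -
  define s where "s = map (psum d) [1..<length d]"
  have "sorted_wrt (<) s"
    unfolding s_def sorted_wrt_map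
    by (rule sorted_wrt_mono_rel[OF _ sorted_wrt_upt]) (use psum_strict_mono[OF assms(2)] in auto)
  moreover have "set s = descent_set n \<alpha>"
    using assms(3) by (simp add: s_def partial_sums_eq_image)
  ultimately have s: "sorted_list_of_set (descent_set n \<alpha>) = s"
    by (metis sorted_list_of_set.idem_if_sorted_distinct strict_sorted_iff)
  show ?thesis unfolding descent_composition_def s Let_def
  proof (rule nth_equalityI)
    show len: "length (map2 (-) (s @ [n]) (0 # s)) = length d" using assms(1) by (simp add: s_def Suc_leI del: upt_Suc)
    fix i assume "i < length (map2 (-) (s @ [n]) (0 # s))"
    then have i: "i < length d" using len by simp
    have "(s @ [n]) ! i = psum d (Suc i)"
      using i assms(4) by (cases "Suc i = length d") (auto simp: s_def nth_append)
    moreover have "(0 # s) ! i = psum d i"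
      using i by (cases i) (auto simp: s_def)
    ultimately show "map2 (-) (s @ [n]) (0 # s) ! i = d ! i"
      using i psum_Suc[OF i] len by simp
  qed
qed

text \<open>Start from \<open>x\<close> and extend in both directions as long as partial sums allow.
  \<open>a\<close> is the least possible left end and \<open>b\<close> the greatest possible right
  end, which gives maximality.\<close>

lemma column_interval_exists:
  assumes "x \<in> {1..sum_list d}"
  shows "\<exists>K\<in>column_intervals d. x \<in> K"
proof -
  define P where "P a \<longleftrightarrow> 1 \<le> a \<and> a \<le> x \<and> (\<forall>j. a \<le> j \<and> j < x \<longrightarrow> j \<in> partial_sums d)" for a
  define Q where "Q b \<longleftrightarrow> x \<le> b \<and> b \<le> sum_list d \<and> (\<forall>j. x \<le> j \<and> j < b \<longrightarrow> j \<in> partial_sums d)" for b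
  have "P x" "Q x" using assms by (auto simp: P_def Q_def)
  define a where "a = (LEAST a. P a)"
  define b where "b = (GREATEST b. Q b)"
  have a: "P a" unfolding a_def using \<open>P x\<close> by (rule LeastI)
  have b: "Q b" unfolding b_def using \<open>Q x\<close> by (rule GreatestI_nat[where b="sum_list d"]) (simp add: Q_def)
  have a1: "a = 1 \<or> a - 1 \<notin> partial_sums d"
  proof (rule ccontr)
    assume *: "\<not> ?thesis"
    have "P (a - 1)" unfolding P_def
    proof (intro conjI allI impI)
      fix j assume "a - 1 \<le> j \<and> j < x"
      then show "j \<in> partial_sums d" using * a by (cases "j = a - 1") (auto simp: P_def)
    qed (use a * in \<open>auto simp: P_def\<close>)
    then have "a \<le> a - 1" unfolding a_def by (rule Least_le)
    then show False using a by (auto simp: P_def)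
  qed
  have b1: "b = sum_list d \<or> b \<notin> partial_sums d"
  proof (rule ccontr)
    assume *: "\<not> ?thesis"
    have "Q (Suc b)" unfolding Q_def
    proof (intro conjI allI impI)
      fix j assume "x \<le> j \<and> j < Suc b"
      then show "j \<in> partial_sums d" using * b by (cases "j = b") (auto simp: Q_def)
    qed (use b * in \<open>auto simp: Q_def\<close>)
    then have "Suc b \<le> Greatest Q"
      by (rule Greatest_le_nat[where b="sum_list d"]) (auto simp: Q_def)
    then show False by (simp add: b_def)
  qed
  have "j \<in> partial_sums d" if "a \<le> j" "j < b" for j
    using a b that by (cases "j < x") (auto simp: P_def Q_def)
  then have "{a..b} \<in> column_intervals d"
    unfolding column_intervals_def using a b a1 b1
    by (intro CollectI exI[of _ a] exI[of _ b]) (auto simp: P_def Q_def)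
  moreover have "x \<in> {a..b}" using a b by (auto simp: P_def Q_def)
  ultimately show ?thesis by blast
qed

lemma Union_column_intervals: "\<Union>(column_intervals d) = {1..sum_list d}"
proof
  show "\<Union>(column_intervals d) \<subseteq> {1..sum_list d}" by (auto simp: column_intervals_def)
qed (use column_interval_exists in blast)

text \<open>Maximality forbids a column from ending or starting in the gap between \<open>x\<close>
  and \<open>Suc x\<close>. This makes the exchange across a row boundary a column
  operation.\<close>

lemma column_interval_Suc_iff:
  assumes "0 \<notin> set d" "x \<in> partial_sums d" "K \<in> column_intervals d"
  shows "x \<in> K \<longleftrightarrow> Suc x \<in> K"
proof -
  obtain a b where K: "K = {a..b}" "a = 1 \<or> a - 1 \<notin> partial_sums d" "b = sum_list d \<or> b \<notin> partial_sums d"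
    using assms(3) by (auto simp: column_intervals_def)
  have x: "1 \<le> x" "x < sum_list d" using partial_sums_bounds[OF assms(1)] assms(2) by auto
  have "x \<noteq> b" using K(3) x assms(2) by auto
  moreover have "Suc x \<noteq> a" using K(2) x assms(2) by auto
  ultimately show ?thesis using K(1) by auto
qed

section \<open>Merging adjacent blocks, and boundaries of single faces\<close>

lemma length_sigma [simp]: "length (sigma \<alpha> c) = length c"
  by (simp add: sigma_def)

lemma nth_sigma [simp]: "i < length c \<Longrightarrow> sigma \<alpha> c ! i = \<alpha> ` row_interval c i"
  by (simp add: sigma_def)

lemma merge_cong:
  assumes "length C = length C'" "Suc i < length C"
    "\<And>j. j < length C \<Longrightarrow> j \<noteq> i \<Longrightarrow> j \<noteq> Suc i \<Longrightarrow> C ! j = C' ! j"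
    "C ! i \<union> C ! Suc i = C' ! i \<union> C' ! Suc i"
  shows "merge C i = merge C' i"
proof -
  have "take i C = take i C'" using assms(1,2,3) by (intro nth_equalityI) auto
  moreover have "drop (i + 2) C = drop (i + 2) C'" using assms(1,2,3) by (intro nth_equalityI) auto
  ultimately show ?thesis using assms(4) by (simp add: merge_def)
qed

text \<open>\<open>s\<close> ends row \<open>i\<close> and \<open>Suc s\<close> begins row
  \<open>Suc i\<close>, both rows being nonempty. The exchange crosses only the cut that merging
  erases.\<close>

lemma merge_sigma_transpose:
  assumes "Suc i < length c" "s = psum c (Suc i)" "0 \<notin> set c"
  shows "merge (sigma (\<beta> \<circ> transpose s (Suc s)) c) i = merge (sigma \<beta> c) i"
proof (rule merge_cong)
  let ?\<tau> = "transpose s (Suc s)"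
  have lt: "psum c i < s" "s < psum c (Suc (Suc i))"
    using psum_strict_mono[OF assms(3), of i "Suc i"] psum_strict_mono[OF assms(3), of "Suc i" "Suc (Suc i)"] assms by auto
  have s: "s \<in> row_interval c i" "Suc s \<in> row_interval c (Suc i)"
    using lt assms(2) by (auto simp: row_interval_def)
  have im: "?\<tau> ` A = A" if "s \<in> A \<longleftrightarrow> Suc s \<in> A" for A
    using that by (auto simp: transpose_def image_iff)
  have comp: "(\<beta> \<circ> ?\<tau>) ` A = \<beta> ` ?\<tau> ` A" for A by (rule image_comp[symmetric])
  show "sigma (\<beta> \<circ> ?\<tau>) c ! j = sigma \<beta> c ! j" if j: "j < length (sigma (\<beta> \<circ> ?\<tau>) c)" "j \<noteq> i" "j \<noteq> Suc i" for j
  proof -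
    have "s \<notin> row_interval c j" "Suc s \<notin> row_interval c j" using row_interval_unique s j by blast+
    then have "?\<tau> ` row_interval c j = row_interval c j" by (intro im) simp
    then show ?thesis using j(1) by (metis comp length_sigma nth_sigma)
  qed
  show "sigma (\<beta> \<circ> ?\<tau>) c ! i \<union> sigma (\<beta> \<circ> ?\<tau>) c ! Suc i = sigma \<beta> c ! i \<union> sigma \<beta> c ! Suc i"
    using im[of "row_interval c i \<union> row_interval c (Suc i)"] s assms(1)
    by (metis Suc_lessD UnI1 UnI2 comp image_Un nth_sigma)
qed (use assms in auto)

text \<open>Exchanging two adjacent sizes moves only the cut between the two blocks, and merging
  erases exactly this cut.\<close>

lemma merge_sigma_swap:
  assumes "length c' = length c" "Suc i < length c" "c' ! i = c ! Suc i" "c' ! Suc i = c ! i"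
    "\<And>j. j < length c \<Longrightarrow> j \<noteq> i \<Longrightarrow> j \<noteq> Suc i \<Longrightarrow> c' ! j = c ! j"
  shows "merge (sigma \<beta> c') i = merge (sigma \<beta> c) i"
proof (rule merge_cong)
  have le: "psum c' j = psum c j" if "j \<le> i" for j
  proof -
    have "take j c' = take j c" using that assms by (intro nth_equalityI) auto
    then show ?thesis by simp
  qed
  have eq: "psum c' (Suc (Suc i)) = psum c (Suc (Suc i))"
    using assms le[of i] by (simp add: psum_Suc)
  have ge: "psum c' j = psum c j" if "Suc (Suc i) \<le> j" for j
  proof -
    have "take (j - Suc (Suc i)) (drop (Suc (Suc i)) c') = take (j - Suc (Suc i)) (drop (Suc (Suc i)) c)"
      using that assms by (intro nth_equalityI) auto
    moreover have "psum e j = psum e (Suc (Suc i)) + sum_list (take (j - Suc (Suc i)) (drop (Suc (Suc i)) e))" for e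
      using that by (metis le_add_diff_inverse sum_list_append take_add)
    ultimately show ?thesis using eq by simp
  qed
  show "sigma \<beta> c' ! j = sigma \<beta> c ! j" if j: "j < length (sigma \<beta> c')" "j \<noteq> i" "j \<noteq> Suc i" for j
  proof -
    have "row_interval c' j = row_interval c j"
      using le[of j] le[of "Suc j"] ge[of j] ge[of "Suc j"] j by (cases "j < i") (auto simp: row_interval_def)
    then show ?thesis using j assms(1) by simp
  qed
  have un: "row_interval e i \<union> row_interval e (Suc i) = {psum e i<..psum e (Suc (Suc i))}" for e
    using psum_mono[of i "Suc i" e] psum_mono[of "Suc i" "Suc (Suc i)" e] by (auto simp: row_interval_def)
  show "sigma \<beta> c' ! i \<union> sigma \<beta> c' ! Suc i = sigma \<beta> c ! i \<union> sigma \<beta> c ! Suc i"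
    using un[of c] un[of c'] le[of i] eq assms(1,2) by (simp add: image_Un[symmetric])
qed (use assms in auto)

lemma boundary_sum: "boundary (sum f A) = (\<Sum>a\<in>A. boundary (f a))"
  by (induction A rule: infinite_finite_induct) (auto simp: boundary_add boundary_zero)

lemma boundary_single:
  "boundary (Poly_Mapping.single C a) = (\<Sum>i<length C - 1. Poly_Mapping.single (merge C i) ((-1) ^ i * a))"
  by (subst boundary_superset[of "{C}"]) auto

context pointed_knapsack
begin

abbreviation column_group :: "nat list \<Rightarrow> (nat \<Rightarrow> nat) set" where
  "column_group d \<equiv> young_subgroup (column_intervals d)"

lemma g_cycle_eq:
  assumes "d \<in> V lam m n"
  shows "g_cycle lam m n \<alpha> d = (\<Sum>\<gamma>\<in>column_group d. \<Sum>\<rho>\<in>row_group d.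
    Poly_Mapping.single (sigma (\<alpha> \<circ> \<gamma>) (permuted (epsilon lam d) \<rho>)) (of_int (sign \<gamma> * sign \<rho>)))"
  unfolding g_cycle_def W_eq_permuted(1)[OF assms]
  by (subst sum.reindex[OF W_eq_permuted(2)[OF assms]]) (simp add: W_eq_permuted(3)[OF assms])

lemma length_epsilon: "d \<in> V lam m n \<Longrightarrow> length (epsilon lam d) = Suc k"
  using V_facts(9,10) comp_typeD(2) by blast

lemma sum_part_counts: "d \<in> V lam m n \<Longrightarrow> sum_list (part_counts lam d) = Suc k"
  using length_epsilon[of d] by (simp add: part_counts_eq epsilon_eq_concat length_concat)

lemma finite_groups: "finite (column_group d)" "finite (row_group d)"
  by (auto intro!: finite_young_subgroup simp: Union_column_intervals Union_rows)

lemma W_facts: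
  assumes "d \<in> V lam m n" "c \<in> W lam m n d"
  shows "comp_type c = (lam, m)" "c \<noteq> []" "0 \<notin> set c" "length c = Suc k" "sum_list c = n"
proof -
  show ty: "comp_type c = (lam, m)" using assms(2) by (simp add: W_def)
  obtain cs where cs: "c = concat cs" "list_all2 mset_eq cs (blocks lam d)"
    using V_facts(11)[OF assms(1)] assms(2) by blast
  show ne: "c \<noteq> []" using cs(2) unfolding cs(1) V_facts(7)[OF assms(1)] by (auto elim: list_all2_mset_eq_last)
  show "length c = Suc k" "sum_list c = n" using comp_typeD[OF ty ne] by auto
  have "0 \<notin># mset c" using comp_typeD(5)[OF ty ne] lam_pos m_pos by auto
  then show "0 \<notin> set c" by simp
qed

lemma permuted_in_W: "d \<in> V lam m n \<Longrightarrow> \<rho> \<in> row_group d \<Longrightarrow> permuted (epsilon lam d) \<rho> \<in> W lam m n d"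
  using W_eq_permuted(1) by blast

text \<open>Rearranging inside rows preserves the sum of each row. This translates a row boundary
  counted in parts into the same boundary counted in word positions.\<close>

lemma psum_permuted:
  assumes d: "d \<in> V lam m n" and "\<rho> \<in> row_group d" "r \<le> length d"
  shows "psum (permuted (epsilon lam d) \<rho>) (psum (part_counts lam d) r) = psum d r"
proof -
  obtain cs where cs: "permuted (epsilon lam d) \<rho> = concat cs" "list_all2 mset_eq cs (blocks lam d)"
    using V_facts(11)[OF d] permuted_in_W[OF assms(1,2)] by blast
  have "psum (part_counts lam d) r = length (concat (take r cs))"
    unfolding part_counts_eq list_all2_mset_eq_length[OF cs(2), symmetric]
    by (simp add: length_concat take_map)
  moreover have "concat cs = concat (take r cs) @ concat (drop r cs)"
    by (metis append_take_drop_id concat_append)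
  ultimately have "take (psum (part_counts lam d) r) (concat cs) = concat (take r cs)" by simp
  moreover have "sum_list (concat (take r cs)) = sum_list (map sum_list (take r cs))"
    by (rule sum_list_concat)
  moreover have "map sum_list cs = d" using list_all2_mset_eq_sum[OF cs(2)] V_facts(5)[OF d] by simp
  ultimately show ?thesis using cs(1) by (metis take_map)
qed

text \<open>For each merge position \<open>i\<close> the terms cancel in pairs. If the position separates two rows of
  \<open>d\<close>, exchanging the last entry of the upper row with the first one of the lower row is a column
  operation; otherwise the two merged parts belong to the same row and may be swapped in \<open>c\<close>.\<close>

lemma boundary_g_cycle:
  assumes d: "d \<in> V lam m n"
  shows "boundary (g_cycle lam m n \<alpha> d :: nat set list \<Rightarrow>\<^sub>0 'k::field) = 0"
proof -
  let ?E = "epsilon lam d" and ?t = "part_counts lam d"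
  define F :: "nat \<Rightarrow> (nat \<Rightarrow> nat) \<Rightarrow> (nat \<Rightarrow> nat) \<Rightarrow> (nat set list \<Rightarrow>\<^sub>0 'k)" where
    "F i \<gamma> \<rho> = Poly_Mapping.single (merge (sigma (\<alpha> \<circ> \<gamma>) (permuted ?E \<rho>)) i) ((-1) ^ i * of_int (sign \<gamma> * sign \<rho>))" for i \<gamma> \<rho>
  have "boundary (g_cycle lam m n \<alpha> d) = (\<Sum>\<gamma>\<in>column_group d. \<Sum>\<rho>\<in>row_group d. \<Sum>i<k. F i \<gamma> \<rho>)"
    by (simp add: g_cycle_eq[OF d] boundary_sum boundary_single F_def length_epsilon[OF d])
  also have "\<dots> = (\<Sum>\<gamma>\<in>column_group d. \<Sum>i<k. \<Sum>\<rho>\<in>row_group d. F i \<gamma> \<rho>)"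
    by (rule sum.cong[OF refl], rule sum.swap)
  also have "\<dots> = (\<Sum>i<k. \<Sum>\<gamma>\<in>column_group d. \<Sum>\<rho>\<in>row_group d. F i \<gamma> \<rho>)"
    by (rule sum.swap)
  also have "\<dots> = 0"
  proof (rule sum.neutral, rule ballI)
    fix i assume "i \<in> {..<k}"
    then have i: "i < k" by simp
    show "(\<Sum>\<gamma>\<in>column_group d. \<Sum>\<rho>\<in>row_group d. F i \<gamma> \<rho>) = 0"
    \<comment> \<open>\<open>i\<close> counts blocks from 0, so the erased cut comes after
      \<open>Suc i\<close> parts. It separates two rows of \<open>d\<close> exactly if this number
      is a partial sum of the part counts.\<close>
    proof (cases "Suc i \<in> partial_sums ?t")
      case True
      then obtain r where r: "Suc i = psum ?t r" "1 \<le> r" "r < length ?t" by (auto simp: partial_sums_def)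
      have rd: "r < length d" using r(3) V_facts(1)[OF d] by (simp add: part_counts_def)
      let ?s = "psum d r"
      have s: "?s \<in> partial_sums d" using r(2) rd by (auto simp: partial_sums_def)
      then have sb: "1 \<le> ?s" "?s < sum_list d" using partial_sums_bounds[OF V_facts(4)[OF d]] by auto
      have "(\<Sum>\<gamma>\<in>column_group d. F i \<gamma> \<rho>) = 0" if \<rho>: "\<rho> \<in> row_group d" for \<rho>
      proof (rule sum_involution_eq_0[where h="\<lambda>\<gamma>. \<gamma> \<circ> transpose ?s (Suc ?s)"])
        fix \<gamma> assume g: "\<gamma> \<in> column_group d"
        then have perm: "\<gamma> permutes {1..sum_list d}"
          by (simp add: young_subgroup_def Union_column_intervals)
        show "\<gamma> \<circ> transpose ?s (Suc ?s) \<in> column_group d"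
          using g sb by (rule_tac young_subgroup_transpose)
            (auto simp: Union_column_intervals column_interval_Suc_iff[OF V_facts(4)[OF d] s])
        show "\<gamma> \<circ> transpose ?s (Suc ?s) \<circ> transpose ?s (Suc ?s) = \<gamma>" by (simp add: comp_assoc)
        show "\<gamma> \<circ> transpose ?s (Suc ?s) \<noteq> \<gamma>" by (rule comp_transpose_neq[OF perm]) simp
        have sg: "sign (\<gamma> \<circ> transpose ?s (Suc ?s)) = - sign \<gamma>"
          by (rule sign_comp_transpose[OF perm]) auto
        have "merge (sigma (\<alpha> \<circ> \<gamma> \<circ> transpose ?s (Suc ?s)) (permuted ?E \<rho>)) i = merge (sigma (\<alpha> \<circ> \<gamma>) (permuted ?E \<rho>)) i"
        proof (rule merge_sigma_transpose)
          show "Suc i < length (permuted ?E \<rho>)" using i by (simp add: length_epsilon[OF d])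
          show "?s = psum (permuted ?E \<rho>) (Suc i)" using psum_permuted[OF d \<rho>, of r] rd r by simp
          show "0 \<notin> set (permuted ?E \<rho>)" using W_facts(3)[OF d permuted_in_W[OF d \<rho>]] .
        qed
        then show "F i (\<gamma> \<circ> transpose ?s (Suc ?s)) \<rho> = - F i \<gamma> \<rho>"
          by (simp add: F_def sg o_assoc single_uminus)
      qed (rule finite_groups)
      then show ?thesis by (subst sum.swap) simp
    next
      case False
      have "(\<Sum>\<rho>\<in>row_group d. F i \<gamma> \<rho>) = 0" if "\<gamma> \<in> column_group d" for \<gamma>
      proof (rule sum_involution_eq_0[where h="\<lambda>\<rho>. \<rho> \<circ> transpose (Suc i) (Suc (Suc i))"])
        fix \<rho> assume r: "\<rho> \<in> row_group d"
        then have perm: "\<rho> permutes {1..Suc k}"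
          by (simp add: young_subgroup_def Union_rows sum_part_counts[OF d])
        let ?\<tau> = "transpose (Suc i) (Suc (Suc i))"
        show "\<rho> \<circ> ?\<tau> \<in> row_group d"
          using r
        proof (rule young_subgroup_transpose)
          show "Suc i \<in> \<Union>(row_intervals ?t)" "Suc (Suc i) \<in> \<Union>(row_intervals ?t)"
            unfolding Union_rows sum_part_counts[OF d] using i by auto
          show "Suc i \<in> K \<longleftrightarrow> Suc (Suc i) \<in> K" if "K \<in> row_intervals ?t" for K
            using that row_interval_Suc_iff[OF False] i sum_part_counts[OF d] by auto
        qed
        show "\<rho> \<circ> ?\<tau> \<circ> ?\<tau> = \<rho>" by (simp add: comp_assoc)
        show "\<rho> \<circ> ?\<tau> \<noteq> \<rho>" by (rule comp_transpose_neq[OF perm]) simp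
        have sg: "sign (\<rho> \<circ> ?\<tau>) = - sign \<rho>"
          by (rule sign_comp_transpose[OF perm]) auto
        have "merge (sigma (\<alpha> \<circ> \<gamma>) (permuted ?E (\<rho> \<circ> ?\<tau>))) i = merge (sigma (\<alpha> \<circ> \<gamma>) (permuted ?E \<rho>)) i"
          by (rule merge_sigma_swap) (use i in \<open>auto simp: length_epsilon[OF d] nth_permuted transpose_def\<close>)
        then show "F i \<gamma> (\<rho> \<circ> ?\<tau>) = - F i \<gamma> \<rho>"
          by (simp add: F_def sg single_uminus)
      qed (rule finite_groups)
      then show ?thesis by simp
    qed
  qed
  finally show ?thesis .
qed

end

section \<open>Facets and the largest facet of a cycle\<close>

lemma ordered_set_partition_facts:
  assumes "C \<in> ordered_set_partitions n"
  shows "C \<noteq> []" "distinct (butlast C)" "disjoint (set (butlast C))"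
    "\<And>X. X \<in> set (butlast C) \<Longrightarrow> X \<noteq> {} \<and> X \<inter> last C = {}"
    "\<Union>(set (butlast C)) \<union> last C = {1..n}"
    "(set (butlast C), last C) \<in> pointed_set_partitions n"
    "psp_type (set (butlast C), last C) = comp_type (map card C)"
    "\<And>i j. i < length C \<Longrightarrow> j < length C \<Longrightarrow> i \<noteq> j \<Longrightarrow> C ! i \<inter> C ! j = {}"
proof -
  have C: "C \<noteq> []" "{} \<notin> set (butlast C)" "\<Union>(set C) = {1..n}"
    "\<And>i j. i < j \<Longrightarrow> j < length C \<Longrightarrow> C ! i \<inter> C ! j = {}"
    using assms by (auto simp: ordered_set_partitions_def)
  show "C \<noteq> []" by (fact C)
  show dis: "\<And>i j. i < length C \<Longrightarrow> j < length C \<Longrightarrow> i \<noteq> j \<Longrightarrow> C ! i \<inter> C ! j = {}"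
    using C(4) by (metis Int_commute linorder_neqE_nat)
  show dd: "distinct (butlast C)"
    unfolding distinct_conv_nth
  proof (intro allI impI)
    fix i j assume ij: "i < length (butlast C)" "j < length (butlast C)" "i \<noteq> j"
    then have "butlast C ! i \<inter> butlast C ! j = {}" using dis[of i j] by (simp add: nth_butlast)
    moreover have "butlast C ! i \<noteq> {}" using C(2) ij(1) by (metis nth_mem)
    ultimately show "butlast C ! i \<noteq> butlast C ! j" by auto
  qed
  show dj: "disjoint (set (butlast C))"
    unfolding disjoint_def
  proof (intro ballI impI)
    fix X Y assume "X \<in> set (butlast C)" "Y \<in> set (butlast C)" "X \<noteq> Y"
    then obtain i j where "i < length C - 1" "j < length C - 1" "X = butlast C ! i" "Y = butlast C ! j"
      by (metis in_set_conv_nth length_butlast)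
    then show "X \<inter> Y = {}" using dis[of i j] \<open>X \<noteq> Y\<close> by (cases "i = j") (auto simp: nth_butlast)
  qed
  show mem: "X \<noteq> {} \<and> X \<inter> last C = {}" if X: "X \<in> set (butlast C)" for X
  proof -
    obtain i where "i < length C - 1" "X = butlast C ! i" using X
      by (metis in_set_conv_nth length_butlast)
    then show ?thesis using dis[of i "length C - 1"] C(1,2) X by (auto simp: nth_butlast last_conv_nth)
  qed
  have "set C = set (butlast C @ [last C])" using C(1) by simp
  then have "set C = insert (last C) (set (butlast C))" by simp
  then show un: "\<Union>(set (butlast C)) \<union> last C = {1..n}" using C(3) by auto
  show "(set (butlast C), last C) \<in> pointed_set_partitions n"
    using un mem dj unfolding pointed_set_partitions_def partition_on_def by blast
  show "psp_type (set (butlast C), last C) = comp_type (map card C)"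
    using dd C(1) by (simp add: psp_type_def comp_type_def mset_set_set map_butlast[symmetric] last_map)
qed

text \<open>Described by block sizes alone; \<open>Lambda_facets\<close> and
  \<open>facets_subset_Lambda\<close> show that these are the faces of the complex with
  \<open>Suc k\<close> blocks.\<close>

definition facets :: "nat multiset \<Rightarrow> nat \<Rightarrow> nat \<Rightarrow> nat set list set" where
  "facets lam m n = {C \<in> ordered_set_partitions n. comp_type (map card C) = (lam, m)}"

lemma mset_sorted_list_of_set: "mset (sorted_list_of_set A) = mset_set A"
  by (metis mset_sorted_list_of_multiset sorted_list_of_mset_set)

lemma pair_subseteq_mset: "i < j \<Longrightarrow> j < length xs \<Longrightarrow> {#xs ! i, xs ! j#} \<subseteq># mset xs"
proof -
  assume ij: "i < j" "j < length xs"
  have "xs = take i xs @ xs ! i # drop (Suc i) xs" using ij by (simp add: id_take_nth_drop[symmetric])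
  then have "mset xs = mset (take i xs) + add_mset (xs ! i) (mset (drop (Suc i) xs))"
    by (metis mset.simps(2) mset_append)
  moreover have "xs ! j \<in># mset (drop (Suc i) xs)"
    using ij by (auto simp: in_set_conv_nth intro!: exI[of _ "j - Suc i"])
  then obtain M where "mset (drop (Suc i) xs) = add_mset (xs ! j) M" by (metis insert_DiffM)
  ultimately show ?thesis by simp
qed

lemma nth_merge:
  assumes "Suc i < length C"
  shows "l < i \<Longrightarrow> merge C i ! l = C ! l" "merge C i ! i = C ! i \<union> C ! Suc i"
  using assms by (auto simp: merge_def nth_append nth_Cons' Suc_diff_Suc)

text \<open>All words of facets have length \<open>n\<close>, so the lexicographic order of the keys compares the words
  first and breaks ties by the composition.\<close>

definition key :: "nat set list \<Rightarrow> nat list" where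
  "key C = concat (map sorted_list_of_set C) @ map card C"

definition ascent :: "nat set \<Rightarrow> nat set \<Rightarrow> bool" where
  "ascent A B \<longleftrightarrow> (\<forall>a\<in>A. \<forall>b\<in>B. a < b)"

context pointed_knapsack
begin

text \<open>An element \<open>y\<close> of a non-pointed block \<open>Y\<close> of \<open>C\<close>
  avoids the pointed block of \<open>C\<close>, hence also \<open>Z\<close>, so it lies in a block
  of \<open>B\<close>, which must be contained in \<open>Y\<close>. Choosing one such block for each
  \<open>Y\<close> is injective and gives the bound. With \<open>k\<close> blocks on both sides the
  choice is onto, and then every \<open>Y\<close> equals its chosen block.\<close>

lemma Lambda_facets:
  assumes "C \<in> Lambda_complex lam m n"
  shows "length C \<le> Suc k" "length C = Suc k \<Longrightarrow> C \<in> facets lam m n"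
proof -
  let ?B' = "set (butlast C)" and ?Z' = "last C"
  have C: "C \<in> ordered_set_partitions n" using assms by (simp add: Lambda_complex_def)
  note O = ordered_set_partition_facts[OF C]
  obtain B Z where BZ: "(B, Z) \<in> pointed_set_partitions n" "psp_type (B, Z) = (lam, m)" "psp_le (B, Z) (?B', ?Z')"
    using assms unfolding Lambda_complex_def psp_filter_def by auto
  have part: "Z \<subseteq> {1..n}" "\<Union>B = {1..n} - Z" "disjoint B" "{} \<notin> B"
    using BZ(1) by (auto simp: pointed_set_partitions_def partition_on_def)
  have "finite (\<Union>B)" unfolding part(2) by simp
  then have finB: "finite B" by (rule finite_UnionD)
  have cardB: "card B = k" using BZ(2) k finB by (auto simp: psp_type_def)
  have le: "\<And>X. X \<in> B \<Longrightarrow> \<exists>Y\<in>insert ?Z' ?B'. X \<subseteq> Y" "Z \<subseteq> ?Z'"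
    using BZ(3) by (auto simp: psp_le_def)
  have same: "Y = Y'" if "Y \<in> ?B'" "Y' \<in> ?B'" "y \<in> Y" "y \<in> Y'" for Y Y' y
    using disjointD[OF O(3) that(1,2)] that(3,4) by blast
  have cover: "\<exists>X\<in>B. y \<in> X \<and> X \<subseteq> Y" if Y: "Y \<in> ?B'" "y \<in> Y" for Y y
  proof -
    have "y \<in> {1..n}" "y \<notin> ?Z'" using O(4)[OF Y(1)] O(5) Y by blast+
    then have "y \<in> \<Union>B" using part(2) le(2) by blast
    then obtain X where X: "X \<in> B" "y \<in> X" by blast
    then obtain Y' where "Y' \<in> insert ?Z' ?B'" "X \<subseteq> Y'" using le(1) by blast
    moreover from this have "Y' \<in> ?B'" using X(2) \<open>y \<notin> ?Z'\<close> by blast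
    then have "Y' = Y" using same[OF _ Y(1) _ Y(2)] X(2) \<open>X \<subseteq> Y'\<close> by blast
    ultimately show ?thesis using X by blast
  qed
  have "\<exists>X\<in>B. X \<subseteq> Y" if Y: "Y \<in> ?B'" for Y
  proof -
    obtain y where "y \<in> Y" using O(4)[OF Y] by blast
    from cover[OF Y this] show ?thesis by blast
  qed
  then obtain f where f: "\<And>Y. Y \<in> ?B' \<Longrightarrow> f Y \<in> B \<and> f Y \<subseteq> Y" by metis
  have inj: "inj_on f ?B'"
  proof (rule inj_onI)
    fix Y Y' assume Y: "Y \<in> ?B'" "Y' \<in> ?B'" "f Y = f Y'"
    then have "f Y \<noteq> {}" "f Y \<subseteq> Y \<inter> Y'" using f part(4) by (metis, metis Int_greatest)
    then show "Y = Y'" using same[OF Y(1,2)] by blast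
  qed
  have card': "card ?B' = length C - 1" using O(2) by (simp add: distinct_card)
  have "card ?B' \<le> card B" using f finB by (intro card_inj_on_le[OF inj]) auto
  then show "length C \<le> Suc k" using card' cardB by simp
  assume len: "length C = Suc k"
  have "f ` ?B' = B"
    using f finB card' cardB len card_image[OF inj] by (intro card_subset_eq) auto
  moreover have "f Y = Y" if Y: "Y \<in> ?B'" for Y
  proof
    show "f Y \<subseteq> Y" using f Y by blast
    show "Y \<subseteq> f Y"
    proof
      fix y assume y: "y \<in> Y"
      then obtain X where X: "X \<in> B" "y \<in> X" "X \<subseteq> Y" using cover Y by blast
      then obtain Y' where "Y' \<in> ?B'" "X = f Y'" using \<open>f ` ?B' = B\<close> by blast
      then have "Y' = Y" using same[OF _ Y] f X(2) y by blast
      then show "y \<in> f Y" using X \<open>X = f Y'\<close> by simp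
    qed
  qed
  ultimately have "B = ?B'" by simp
  moreover have "Z = ?Z'"
  proof -
    have "?Z' \<inter> \<Union>?B' = {}" using O(4) by blast
    then show ?thesis using part(1,2) O(5) \<open>B = ?B'\<close> le(2) by blast
  qed
  ultimately show "C \<in> facets lam m n" using BZ(2) O(7) C by (simp add: facets_def)
qed

lemma facets_subset_Lambda: "facets lam m n \<subseteq> {C \<in> Lambda_complex lam m n. length C = Suc k}"
proof
  fix C assume "C \<in> facets lam m n"
  then have C: "C \<in> ordered_set_partitions n" "comp_type (map card C) = (lam, m)" by (auto simp: facets_def)
  note O = ordered_set_partition_facts[OF C(1)]
  have "psp_le (set (butlast C), last C) (set (butlast C), last C)" by (auto simp: psp_le_def)
  then have "C \<in> Lambda_complex lam m n"
    using O(6,7) C unfolding Lambda_complex_def psp_filter_def by auto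
  moreover have "length C = Suc k" using comp_typeD(2)[OF C(2)] O(1) by simp
  ultimately show "C \<in> {C \<in> Lambda_complex lam m n. length C = Suc k}" by simp
qed

lemma chains_Lambda:
  "chains (Lambda_complex lam m n) (int k - 1) = {z. Poly_Mapping.keys z \<subseteq> facets lam m n}"
proof -
  have "{C \<in> Lambda_complex lam m n. int (length C) - 2 = int k - 1} = facets lam m n"
    using Lambda_facets(2) facets_subset_Lambda by force
  then show ?thesis unfolding chains_def by simp
qed

lemma boundaries_Lambda: "boundaries (Lambda_complex lam m n) (int k - 1) = {0}"
proof -
  have none: "{C \<in> Lambda_complex lam m n. int (length C) - 2 = int k - 1 + 1} = {}"
    using Lambda_facets(1) by force
  show ?thesis unfolding boundaries_def chains_def none by (simp add: boundary_zero)
qed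

lemma facet_facts:
  assumes "C \<in> facets lam m n"
  shows "length C = Suc k" "C \<noteq> []" "mset (map card (butlast C)) = lam" "card (last C) = m"
    "\<And>i. i < length C \<Longrightarrow> finite (C ! i)" "\<And>i. i < length C \<Longrightarrow> C ! i \<noteq> {}"
    "\<And>i j. i < length C \<Longrightarrow> j < length C \<Longrightarrow> i \<noteq> j \<Longrightarrow> C ! i \<inter> C ! j = {}"
    "\<Union>(set C) = {1..n}" "set C \<subseteq> Pow {1..n}"
proof -
  have C: "C \<in> ordered_set_partitions n" "comp_type (map card C) = (lam, m)" using assms by (auto simp: facets_def)
  note O = ordered_set_partition_facts[OF C(1)]
  show ne: "C \<noteq> []" by (fact O(1))
  show "length C = Suc k" using comp_typeD(2)[OF C(2)] ne by simp
  show ty: "mset (map card (butlast C)) = lam" "card (last C) = m"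
    using C(2) ne by (auto simp: comp_type_def map_butlast[symmetric] last_map)
  show U: "\<Union>(set C) = {1..n}" using C(1) by (simp add: ordered_set_partitions_def)
  then show P: "set C \<subseteq> Pow {1..n}" by blast
  fix i assume i: "i < length C"
  then have "C ! i \<in> set C" by simp
  then show "finite (C ! i)" using P finite_subset[of "C ! i" "{1..n}"] by auto
  \<comment> \<open>Only the pointed block could be empty, and its size is
    \<open>m > 0\<close>.\<close>
  show "C ! i \<noteq> {}"
  proof (cases "i < length (butlast C)")
    case True
    then show ?thesis using O(4)[of "C ! i"] by (metis nth_butlast nth_mem)
  next
    case False
    then have "C ! i = last C" using i ne by (metis One_nat_def Suc_pred last_conv_nth length_butlast length_greater_0_conv less_antisym)
    then show ?thesis using ty(2) m_pos by auto
  qed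
next
  show "\<And>i j. i < length C \<Longrightarrow> j < length C \<Longrightarrow> i \<noteq> j \<Longrightarrow> C ! i \<inter> C ! j = {}"
    using ordered_set_partition_facts(8)[of C n] assms by (simp add: facets_def)
qed

lemma finite_facets: "finite (facets lam m n)"
proof -
  have "facets lam m n \<subseteq> {C. set C \<subseteq> Pow {1..n} \<and> length C = Suc k}" using facet_facts(1,9) by blast
  then show ?thesis by (rule finite_subset) (simp add: finite_lists_length_eq)
qed

section \<open>Facets that share a codimension-one face\<close>

lemma card_pair_subseteq:
  assumes "C \<in> facets lam m n" "Suc i < k"
  shows "{#card (C ! i), card (C ! Suc i)#} \<subseteq># lam"
  using pair_subseteq_mset[of i "Suc i" "map card (butlast C)"] facet_facts(1,3)[OF assms(1)] assms(2)
  by (simp add: nth_butlast)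

lemma card_single_subseteq:
  assumes "C \<in> facets lam m n" "i < k"
  shows "{#card (C ! i)#} \<subseteq># lam"
proof -
  have "map card (butlast C) ! i \<in># mset (map card (butlast C))"
    using assms facet_facts(1)[OF assms(1)] by (intro nth_mem_mset) simp
  then show ?thesis using facet_facts(1,3)[OF assms(1)] assms(2) by (simp add: nth_butlast del: set_mset_mset mset_map)
qed

lemma card_merged:
  assumes "C \<in> facets lam m n" "Suc i < length C"
  shows "card (C ! i \<union> C ! Suc i) = card (C ! i) + card (C ! Suc i)"
  using facet_facts(5,7)[OF assms(1)] assms(2) by (intro card_Un_disjoint) auto

text \<open>For \<open>i < j\<close> the block at \<open>i\<close> in \<open>C'\<close> would be a
  union of two non-pointed blocks of \<open>C\<close>. One part of \<open>lam\<close> would then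
  equal a sum of two parts, against the knapsack property.\<close>

lemma merge_eq_le:
  assumes C: "C \<in> facets lam m n" and C': "C' \<in> facets lam m n" 
    and ij: "Suc i < length C" "Suc j < length C'" and eq: "merge C i = merge C' j"
  shows "j \<le> i"
proof (rule ccontr)
  assume "\<not> j \<le> i"
  then have lt: "i < j" by simp
  have len: "length C = Suc k" "length C' = Suc k" using facet_facts(1) C C' by auto
  have "C ! i \<union> C ! Suc i = C' ! i"
    using eq nth_merge(2)[OF ij(1)] nth_merge(1)[OF ij(2) lt] by simp
  then have "card (C ! i) + card (C ! Suc i) = card (C' ! i)" using card_merged[OF C ij(1)] by simp
  moreover have "{#card (C ! i), card (C ! Suc i)#} \<subseteq># lam" using lt ij len by (intro card_pair_subseteq[OF C]) simp
  moreover have "{#card (C' ! i)#} \<subseteq># lam" using lt ij len by (intro card_single_subseteq[OF C']) simp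
  ultimately have "{#card (C ! i), card (C ! Suc i)#} = {#card (C' ! i)#}"
    by (intro knapsackD[OF kn]) auto
  then show False by (auto dest: arg_cong[of _ _ size])
qed

text \<open>For two non-pointed blocks the sum of their sizes determines the pair of sizes up to
  order, by the knapsack property. If the second block is pointed, its size is \<open>m\<close> in
  both facets, so the first size is fixed.\<close>

lemma merge_eqD:
  assumes C: "C \<in> facets lam m n" and C': "C' \<in> facets lam m n" 
    and ij: "Suc i < length C" "Suc j < length C'" and eq: "merge C i = merge C' j"
  shows "j = i" "take i C' = take i C" "drop (i + 2) C' = drop (i + 2) C"
    "C' ! i \<union> C' ! Suc i = C ! i \<union> C ! Suc i"
    "card (C' ! i) = card (C ! i) \<or> Suc i < k \<and> card (C' ! i) = card (C ! Suc i)"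
proof -
  show ji: "j = i" using merge_eq_le[OF C C' ij eq] merge_eq_le[OF C' C ij(2,1) eq[symmetric]] by simp
  have len: "length C = Suc k" "length C' = Suc k" using facet_facts(1) C C' by auto
  show "take i C' = take i C" "drop (i + 2) C' = drop (i + 2) C"
    "C' ! i \<union> C' ! Suc i = C ! i \<union> C ! Suc i"
    using eq ij len unfolding ji merge_def by (auto simp: append_eq_append_conv)
  then have sum: "card (C' ! i) + card (C' ! Suc i) = card (C ! i) + card (C ! Suc i)"
    using card_merged[OF C ij(1)] card_merged[OF C' ij(2)] ji by simp
  show "card (C' ! i) = card (C ! i) \<or> Suc i < k \<and> card (C' ! i) = card (C ! Suc i)"
  proof (cases "Suc i < k")
    case True
    have "{#card (C' ! i), card (C' ! Suc i)#} = {#card (C ! i), card (C ! Suc i)#}"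
      using sum by (intro knapsackD[OF kn] card_pair_subseteq C C' True) simp
    then show ?thesis using True by (auto simp: add_eq_conv_ex)
  next
    case False
    then have "C ! Suc i = last C" "C' ! Suc i = last C'"
      using ij len ji facet_facts(2)[OF C] facet_facts(2)[OF C'] by (auto simp: last_conv_nth) (metis Suc_lessI)+
    then show ?thesis using sum facet_facts(4)[OF C] facet_facts(4)[OF C'] by simp
  qed
qed

lemma split_at_pair: "Suc i < length C \<Longrightarrow> C = take i C @ [C ! i, C ! Suc i] @ drop (i + 2) C"
  by (simp add: Cons_nth_drop_Suc)

text \<open>Across the merged blocks \<open>C\<close> reads off the elements in increasing order, which no other facet
  around \<open>merge C i\<close> can beat; if another one ties, it has the two sizes exchanged and hence the larger
  composition.\<close>

lemma key_less_of_merge_eq: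
  assumes C: "C \<in> facets lam m n" and C': "C' \<in> facets lam m n" and ne: "C' \<noteq> C"
    and ij: "Suc i < length C" "Suc j < length C'" and eq: "merge C i = merge C' j"
    and asc: "ascent (C ! i) (C ! Suc i)" and bad: "Suc i < k \<Longrightarrow> card (C ! i) \<le> card (C ! Suc i)"
  shows "key C < key C'"
proof -
  note M = merge_eqD[OF C C' ij eq]
  let ?s = "sorted_list_of_set :: nat set \<Rightarrow> nat list"
  define A B A' B' where "A = C ! i" and "B = C ! Suc i" and "A' = C' ! i" and "B' = C' ! Suc i"
  have ij': "Suc i < length C'" using ij(2) M(1) by simp
  have fin: "finite A" "finite B" "finite A'" "finite B'" and dis: "A \<inter> B = {}" "A' \<inter> B' = {}"
    using facet_facts(5,7)[OF C] facet_facts(5,7)[OF C'] ij(1) ij' by (auto simp: A_def B_def A'_def B'_def)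
  have Csplit: "C = take i C @ [A, B] @ drop (i + 2) C" and Csplit': "C' = take i C @ [A', B'] @ drop (i + 2) C"
    using split_at_pair[OF ij(1)] split_at_pair[OF ij'] M(2,3) by (simp_all add: A_def B_def A'_def B'_def)
  define pre post where "pre = concat (map ?s (take i C))" and "post = concat (map ?s (drop (i + 2) C))"
  have word: "concat (map ?s C) = pre @ (?s A @ ?s B) @ post"
    by (subst Csplit) (simp add: pre_def post_def)
  have word': "concat (map ?s C') = pre @ (?s A' @ ?s B') @ post"
    by (subst Csplit') (simp add: pre_def post_def)
  have UN: "A' \<union> B' = A \<union> B" using M(4) by (simp add: A_def B_def A'_def B'_def)
  have mset: "mset (?s A @ ?s B) = mset (?s A' @ ?s B')"
    using mset_set_Union[OF fin(1,2) dis(1)] mset_set_Union[OF fin(3,4) dis(2)] UN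
    by (simp add: mset_sorted_list_of_set)
  then have len: "length (?s A @ ?s B) = length (?s A' @ ?s B')" by (metis size_mset)
  have "sorted (?s A @ ?s B)"
    using asc fin by (auto simp: sorted_append ascent_def A_def B_def intro: less_imp_le)
  then have "?s A @ ?s B \<le> ?s A' @ ?s B'" using mset sorted_le_of_mset_eq by blast
  then consider "?s A @ ?s B < ?s A' @ ?s B'" | "?s A @ ?s B = ?s A' @ ?s B'" by fastforce
  then show ?thesis
  proof cases
    case 1
    then have "(?s A @ ?s B) @ (post @ map card C) < (?s A' @ ?s B') @ (post @ map card C')"
      by (rule append_less_append[OF len])
    then show ?thesis unfolding key_def word word' by (simp add: append_less_append_iff)
  next
    case 2
    have "card A' \<noteq> card A"
    proof
      assume "card A' = card A"
      then have "?s A' = ?s A" "?s B' = ?s B" using 2 fin by (auto simp: append_eq_append_conv)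
      then have "A' = A" "B' = B" using fin by (metis set_sorted_list_of_set)+
      then show False using Csplit Csplit' ne by metis
    qed
    \<comment> \<open>Equal sizes having been excluded, \<open>merge_eqD\<close> leaves only two
      non-pointed blocks with exchanged sizes, and \<open>bad\<close> tells which one is
      larger.\<close>
    then have "Suc i < k" "card A' = card B" using M(5) by (auto simp: A_def B_def A'_def)
    then have "card A < card A'" using bad \<open>card A' \<noteq> card A\<close> by (auto simp: A_def B_def)
    then have "map card C < map card C'"
      using M(2) ij(1) ij' by (intro less_list_of_first_difference[of i])
        (auto simp: A_def A'_def take_map)
    then show ?thesis unfolding key_def word word' 2 by (simp add: append_less_append_iff)
  qed
qed

text \<open>If the conclusion failed, every other facet around \<open>merge C i\<close> would have a
  larger key and so be absent from \<open>z\<close>. The boundary coefficient at this face would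
  then have the single summand coming from \<open>C\<close> at position \<open>i\<close>, which is
  nonzero.\<close>

lemma maximal_key_of_cycle:
  fixes z :: "nat set list \<Rightarrow>\<^sub>0 'k::field"
  assumes z: "Poly_Mapping.keys z \<subseteq> facets lam m n" "boundary z = 0"
    and C: "C \<in> Poly_Mapping.keys z" "\<And>C'. C' \<in> Poly_Mapping.keys z \<Longrightarrow> key C' \<le> key C"
    and i: "Suc i < length C" and asc: "ascent (C ! i) (C ! Suc i)"
  shows "Suc i < k \<and> card (C ! Suc i) < card (C ! i)"
proof (rule ccontr)
  assume bad: "\<not> ?thesis"
  have uniq: "C' = C \<and> j = i" if C': "C' \<in> Poly_Mapping.keys z" "Suc j < length C'" "merge C' j = merge C i" for C' j
  proof -
    have F: "C \<in> facets lam m n" "C' \<in> facets lam m n" using z(1) C(1) C'(1) by auto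
    have "C' = C"
    proof (rule ccontr)
      assume "C' \<noteq> C"
      then have "key C < key C'"
        using key_less_of_merge_eq[OF F _ i C'(2) C'(3)[symmetric] asc] bad by auto
      then show False using C(2)[OF C'(1)] by simp
    qed
    then show ?thesis using merge_eqD(1)[OF F i C'(2) C'(3)[symmetric]] by simp
  qed
  have "Poly_Mapping.lookup (boundary z) (merge C i) =
    (\<Sum>C'\<in>Poly_Mapping.keys z. \<Sum>j<length C' - 1. if merge C' j = merge C i then (-1) ^ j * Poly_Mapping.lookup z C' else 0)"
    unfolding boundary_def by (simp add: lookup_sum lookup_single when_def)
  also have "\<dots> = (\<Sum>C'\<in>Poly_Mapping.keys z. if C' = C then
      (\<Sum>j<length C - 1. if j = i then (-1) ^ j * Poly_Mapping.lookup z C else 0) else 0)"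
  proof (rule sum.cong[OF refl])
    fix C' assume C': "C' \<in> Poly_Mapping.keys z"
    have *: "merge C' j = merge C i \<longleftrightarrow> C' = C \<and> j = i" if "j < length C' - 1" for j
      using uniq[OF C', of j] that by auto
    have "(\<Sum>j<length C' - 1. if merge C' j = merge C i then (-1) ^ j * Poly_Mapping.lookup z C' else 0)
      = (\<Sum>j<length C' - 1. if C' = C \<and> j = i then (-1) ^ j * Poly_Mapping.lookup z C' else 0)"
      by (rule sum.cong) (auto simp: *)
    then show "(\<Sum>j<length C' - 1. if merge C' j = merge C i then (-1) ^ j * Poly_Mapping.lookup z C' else 0)
      = (if C' = C then (\<Sum>j<length C - 1. if j = i then (-1) ^ j * Poly_Mapping.lookup z C else 0) else 0)"
      by simp
  qed
  also have "\<dots> = (-1) ^ i * Poly_Mapping.lookup z C"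
    using C(1) i by simp
  finally have "(-1) ^ i * Poly_Mapping.lookup z C = 0" using z(2) by simp
  then show False using C(1) by (simp add: in_keys_iff)
qed

text \<open>All facets have the same number of blocks, so the end of the key gives the sizes, and
  these cut the word back into blocks.\<close>

lemma inj_on_key: "inj_on key (facets lam m n)"
proof (rule inj_onI)
  fix C C' assume C: "C \<in> facets lam m n" "C' \<in> facets lam m n" "key C = key C'"
  let ?s = "sorted_list_of_set :: nat set \<Rightarrow> nat list"
  have len: "length C = length C'" using facet_facts(1) C by simp
  have eq: "concat (map ?s C) = concat (map ?s C')" "map card C = map card C'"
    using C(3) len unfolding key_def by (metis append_eq_append_conv length_map)+
  have fin: "finite X" if "X \<in> set C \<union> set C'" for X
    using that facet_facts(9) C(1,2) finite_subset[of X "{1..n}"] by blast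
  have "map ?s C = map ?s C'"
  proof (rule concat_injective[OF eq(1)])
    show "length (map ?s C) = length (map ?s C')" using len by simp
    show "\<forall>(x, y)\<in>set (zip (map ?s C) (map ?s C')). length x = length y"
    proof (intro ballI, clarify)
      fix x y assume "(x, y) \<in> set (zip (map ?s C) (map ?s C'))"
      then obtain i where "i < length C" "x = ?s (C ! i)" "y = ?s (C' ! i)"
        using len by (auto simp: in_set_zip)
      moreover have "card (C ! i) = card (C' ! i)" using eq(2) len \<open>i < length C\<close> by (metis nth_map)
      ultimately show "length x = length y" by simp
    qed
  qed
  then have "map (set \<circ> ?s) C = map (set \<circ> ?s) C'" by (metis map_map)
  moreover have "map (set \<circ> ?s) D = D" if "D = C \<or> D = C'" for D
    using that fin by (intro map_idI) auto
  ultimately show "C = C'" by simp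
qed

end

section \<open>Facets without a removable ascent\<close>

text \<open>Built from the right: a new head joins the first run if it is related to the head of
  that run, and otherwise starts a run of its own.\<close>

lemma group_runs:
  "\<exists>xss. concat xss = xs \<and> [] \<notin> set xss \<and> (\<forall>g\<in>set xss. successively R g) \<and>
    successively (\<lambda>g h. \<not> R (last g) (hd h)) xss"
proof (induction xs)
  case Nil
  show ?case by (rule exI[of _ "[]"]) simp
next
  case (Cons x xs)
  then obtain xss where xss: "concat xss = xs" "[] \<notin> set xss" "\<forall>g\<in>set xss. successively R g"
    "successively (\<lambda>g h. \<not> R (last g) (hd h)) xss" by blast
  show ?case
  proof (cases xss)
    case Nil
    then show ?thesis using xss(1) by (intro exI[of _ "[[x]]"]) simp
  next
    case (Cons g rest)
    then have g: "g \<noteq> []" using xss(2) by auto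
    show ?thesis
    proof (cases "R x (hd g)")
      case True
      then show ?thesis using xss g unfolding Cons
        by (intro exI[of _ "(x # g) # rest"]) (auto simp: successively_Cons)
    next
      case False
      then show ?thesis using xss g unfolding Cons
        by (intro exI[of _ "[x] # g # rest"]) (auto simp: successively_Cons)
    qed
  qed
qed

lemma successively_concatD: "successively Q (concat xss) \<Longrightarrow> g \<in> set xss \<Longrightarrow> successively Q g"
  by (induction xss) (auto simp: successively_append_iff)

lemma last_concat_last: "xss \<noteq> [] \<Longrightarrow> [] \<notin> set xss \<Longrightarrow> last (concat xss) = last (last xss)"
  by (induction xss rule: rev_induct) auto

lemma sorted_wrt_upt_nth: "sorted_wrt P [a..<b] \<Longrightarrow> a \<le> p \<Longrightarrow> p < q \<Longrightarrow> q < b \<Longrightarrow> P p q"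
  using sorted_wrt_nth_less[of P "[a..<b]" "p - a" "q - a"] by simp

text \<open>Reads \<open>w\<close> as one-line notation with positions starting at 1; outside these
  it is the identity, as \<open>permutes\<close> requires.\<close>

definition word_perm :: "nat list \<Rightarrow> nat \<Rightarrow> nat" where
  "word_perm w j = (if j \<in> {1..length w} then w ! (j - 1) else j)"

lemma word_perm_permutes:
  assumes "distinct w" "set w = {1..length w}"
  shows "word_perm w permutes {1..length w}"
proof (rule bij_imp_permutes)
  have im: "word_perm w ` {1..length w} = set w"
  proof -
    have "word_perm w ` {1..length w} = (\<lambda>i. word_perm w (Suc i)) ` {..<length w}"
      by (simp add: image_comp[symmetric, of "word_perm w" Suc, unfolded o_def] image_Suc_lessThan)
    also have "\<dots> = set w" by (auto simp: word_perm_def set_conv_nth)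
    finally show ?thesis .
  qed
  then show "bij_betw (word_perm w) {1..length w} {1..length w}"
    using assms(2) by (simp add: bij_betw_def eq_card_imp_inj_on)
qed (auto simp: word_perm_def)

lemma map_word_perm_row_list:
  assumes "i < length es"
  shows "map (word_perm (concat es)) (row_list (map length es) i) = es ! i"
proof -
  have "set (row_list (map length es) i) \<subseteq> {1..length (concat es)}"
    using assms UN_row_interval[of "map length es"] unfolding set_row_list by (auto simp: length_concat)
  then show ?thesis by (subst nth_block[OF assms]) (auto simp: word_perm_def)
qed

lemma sigma_word_perm:
  assumes "\<And>X. X \<in> set C \<Longrightarrow> finite X"
  shows "sigma (word_perm (concat (map sorted_list_of_set C))) (map card C) = C"
proof (rule nth_equalityI)
  fix i assume "i < length (sigma (word_perm (concat (map sorted_list_of_set C))) (map card C))"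
  then have i: "i < length C" by simp
  have len: "map length (map sorted_list_of_set C) = map card C" by simp
  have "map (word_perm (concat (map sorted_list_of_set C))) (row_list (map card C) i) = sorted_list_of_set (C ! i)"
    using map_word_perm_row_list[of i "map sorted_list_of_set C"] i unfolding len by simp
  from arg_cong[OF this, of set] show "sigma (word_perm (concat (map sorted_list_of_set C))) (map card C) ! i = C ! i"
    using i assms by (simp add: set_row_list)
qed simp

text \<open>Inside a block the word increases. Across a boundary some \<open>a\<close> before it is
  at least some \<open>b\<close> after it, so the last letter before is at least the first letter
  after, and distinctness makes this a descent.\<close>

lemma descent_set_word_perm:
  assumes "\<And>e. e \<in> set es \<Longrightarrow> e \<noteq> [] \<and> sorted_wrt (<) e"
    and "successively (\<lambda>e f. \<exists>a\<in>set e. \<exists>b\<in>set f. b \<le> a) es" and "distinct (concat es)"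
  shows "descent_set (length (concat es)) (word_perm (concat es)) = partial_sums (map length es)"
proof -
  let ?t = "map length es" and ?w = "concat es" and ?N = "length (concat es)"
  let ?\<alpha> = "word_perm ?w"
  have N: "sum_list ?t = ?N" by (simp add: length_concat)
  have pos: "0 \<notin> set ?t" using assms(1) by auto
  have mono: "?\<alpha> p < ?\<alpha> q" if "i < length es" "p \<in> row_interval ?t i" "q \<in> row_interval ?t i" "p < q" for i p q
  proof -
    have "sorted_wrt (<) (map ?\<alpha> (row_list ?t i))"
      using map_word_perm_row_list[OF that(1)] assms(1) that(1) by simp
    then have "sorted_wrt (\<lambda>x y. ?\<alpha> x < ?\<alpha> y) [Suc (psum ?t i)..<Suc (psum ?t (Suc i))]"
      by (simp add: sorted_wrt_map row_list_def del: upt_Suc)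
    then show ?thesis by (rule sorted_wrt_upt_nth) (use that in \<open>auto simp: row_interval_def\<close>)
  qed
  show ?thesis
  proof (intro equalityI subsetI)
    fix j assume "j \<in> descent_set ?N ?\<alpha>"
    then have j: "1 \<le> j" "j < ?N" "?\<alpha> (Suc j) < ?\<alpha> j" by (auto simp: descent_set_def)
    show "j \<in> partial_sums ?t"
    proof (rule ccontr)
      assume np: "j \<notin> partial_sums ?t"
      have "j \<in> (\<Union>i<length ?t. row_interval ?t i)" unfolding UN_row_interval N using j by simp
      then obtain i where i: "i < length es" "j \<in> row_interval ?t i" by auto
      then have "Suc j \<in> row_interval ?t i"
        using row_interval_Suc_iff[OF np j(1)] j(2) N by simp
      then show False using mono[OF i, of "Suc j"] j(3) by simp
    qed
  next
    fix j assume j: "j \<in> partial_sums ?t"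
    then have jb: "1 \<le> j" "j < ?N" using partial_sums_bounds[OF pos] N by auto
    obtain r where r: "j = psum ?t (Suc r)" "Suc r < length es"
    proof -
      obtain r where "j = psum ?t r" "1 \<le> r" "r < length ?t" using j by (auto simp: partial_sums_def)
      then show ?thesis using that[of "r - 1"] by simp
    qed
    obtain a b where ab: "a \<in> set (es ! r)" "b \<in> set (es ! Suc r)" "b \<le> a"
      using successively_nth[OF assms(2) r(2)] by blast
    have im: "set (es ! i) = ?\<alpha> ` row_interval ?t i" if "i < length es" for i
      using map_word_perm_row_list[OF that] by (metis set_map set_row_list)
    obtain p q where p: "p \<in> row_interval ?t r" "a = ?\<alpha> p" and q: "q \<in> row_interval ?t (Suc r)" "b = ?\<alpha> q"
      using ab im[of r] im[of "Suc r"] r(2) by auto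
    have jr: "j \<in> row_interval ?t r" "Suc j \<in> row_interval ?t (Suc r)"
      using psum_strict_mono[OF pos, of r "Suc r"] psum_strict_mono[OF pos, of "Suc r" "Suc (Suc r)"] r
      by (auto simp: row_interval_def)
    have "p \<le> j" "Suc j \<le> q" using p q r(1) by (auto simp: row_interval_def)
    then have "?\<alpha> p \<le> ?\<alpha> j" "?\<alpha> (Suc j) \<le> ?\<alpha> q"
      using mono[of r p j] mono[of "Suc r" "Suc j" q] r(2) p q jr by (auto simp: le_less)
    moreover have "?\<alpha> j \<noteq> ?\<alpha> (Suc j)"
      using jb assms(3) by (auto simp: word_perm_def nth_eq_iff_index_eq)
    ultimately show "j \<in> descent_set ?N ?\<alpha>" using ab(3) p q jb by (auto simp: descent_set_def)
  qed
qed

text \<open>Nonempty blocks make \<open>ascent\<close> transitive, so ascents between neighbours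
  yield ascents between all pairs; an empty block in between would break the chain.\<close>

lemma sorted_concat_ascent:
  assumes "successively ascent g" "\<forall>X\<in>set g. finite X \<and> X \<noteq> {}"
  shows "sorted_wrt (<) (concat (map sorted_list_of_set g))"
proof -
  have "sorted_wrt ascent g"
    using assms(1)
  proof (subst (asm) successively_iff_sorted_wrt_strong)
    fix X Y Z assume "X \<in> set g" "Y \<in> set g" "Z \<in> set g" "ascent X Y" "ascent Y Z"
    then show "ascent X Z" using assms(2) unfolding ascent_def by (meson all_not_in_conv order.strict_trans)
  qed
  then show ?thesis using assms(2)
    by (induction g) (auto simp: sorted_wrt_append ascent_def)
qed

context pointed_knapsack
begin

lemma word_facets:
  assumes "C \<in> facets lam m n"
  shows "length (concat (map sorted_list_of_set C)) = n" "distinct (concat (map sorted_list_of_set C))"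
    "set (concat (map sorted_list_of_set C)) = {1..n}" "\<And>X. X \<in> set C \<Longrightarrow> finite X \<and> X \<noteq> {}"
proof -
  have fin: "finite X \<and> X \<noteq> {}" if "X \<in> set C" for X
    using that facet_facts(5,6)[OF assms] by (metis in_set_conv_nth)
  then show "\<And>X. X \<in> set C \<Longrightarrow> finite X \<and> X \<noteq> {}" .
  show set: "set (concat (map sorted_list_of_set C)) = {1..n}"
    using facet_facts(8)[OF assms] fin by auto
  have "comp_type (map card C) = (lam, m)" using assms by (simp add: facets_def)
  then have "sum_list (map card C) = n" using facet_facts(2)[OF assms] comp_typeD(3) by simp
  then show len: "length (concat (map sorted_list_of_set C)) = n" by (simp add: length_concat o_def)
  show "distinct (concat (map sorted_list_of_set C))"
    by (rule card_distinct) (simp only: set len, simp)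
qed

text \<open>The rows of \<open>d\<close> are the maximal runs of blocks of \<open>C\<close> along which the word is increasing.\<close>

lemma good_facet_is_leading:
  assumes C: "C \<in> facets lam m n"
    and good: "\<And>i. Suc i < length C \<Longrightarrow> ascent (C ! i) (C ! Suc i) \<Longrightarrow> Suc i < k \<and> card (C ! Suc i) < card (C ! i)"
  shows "\<exists>d \<alpha>. d \<in> V lam m n \<and> \<alpha> permutes {1..n} \<and> descent_composition n \<alpha> = d \<and> sigma \<alpha> (epsilon lam d) = C"
proof -
  let ?sl = "sorted_list_of_set :: nat set \<Rightarrow> nat list"
  note WF = word_facets[OF C]
  obtain C0 Z where CZ: "C = C0 @ [Z]" using facet_facts(2)[OF C] by (cases C rule: rev_cases) auto
  have len0: "length C0 = k" using facet_facts(1)[OF C] CZ by simp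
  have cards: "mset (map card C0) = lam" "card Z = m" using facet_facts(3,4)[OF C] CZ by auto
  obtain xss where xss: "concat xss = C0" "[] \<notin> set xss" "\<forall>g\<in>set xss. successively ascent g"
    "successively (\<lambda>g h. \<not> ascent (last g) (hd h)) xss"
    using group_runs[of C0 ascent] by blast
  define G where "G = xss @ [[Z]]"
  have CG: "concat G = C" by (simp add: G_def xss(1) CZ)
  have Gne: "[] \<notin> set G" using xss(2) by (auto simp: G_def)
  have Gasc: "\<And>g. g \<in> set G \<Longrightarrow> successively ascent g" using xss(3) by (auto simp: G_def)
  have GC: "\<And>g X. g \<in> set G \<Longrightarrow> X \<in> set g \<Longrightarrow> X \<in> set C" using CG by auto
  \<comment> \<open>At \<open>i = k - 1\<close> the conclusion \<open>Suc i < k\<close> of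
    \<open>good\<close> fails, so no ascent leads into the pointed block and it may be kept as a
    separate run.\<close>
  have lastG: "\<not> ascent (last (last xss)) Z" if "xss \<noteq> []"
  proof -
    have "C0 \<noteq> []" using xss(1,2) that by (cases xss) auto
    then have **: "last C0 = C ! (k - 1)" "Z = C ! Suc (k - 1)" "0 < k"
      using len0 by (auto simp: CZ nth_append last_conv_nth)
    have "last C0 = last (last xss)" using last_concat_last[OF that xss(2)] unfolding xss(1) .
    moreover have "Suc (k - 1) < length C" using **(3) len0 by (simp add: CZ)
    ultimately show ?thesis using good[of "k - 1"] ** by auto
  qed
  have Gsucc: "successively (\<lambda>g h. \<not> ascent (last g) (hd h)) G"
    using xss(4) lastG by (auto simp: G_def successively_append_iff)
  \<comment> \<open>All steps inside a run are ascents, and \<open>good\<close> makes the sizes drop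
    at each ascent. Hence the sizes are distinct and already in the order that
    \<open>part_list\<close> produces.\<close>
  have Gdec: "sorted_wrt (>) (map card g)" if "g \<in> set xss" for g
  proof -
    have "successively (\<lambda>X Y. ascent X Y \<longrightarrow> card Y < card X) (concat xss)"
      unfolding successively_conv_nth xss(1)
    proof (intro allI impI)
      fix i assume "Suc i < length C0" "ascent (C0 ! i) (C0 ! Suc i)"
      then show "card (C0 ! Suc i) < card (C0 ! i)" using good[of i] by (simp add: CZ nth_append)
    qed
    then have "successively (\<lambda>X Y. ascent X Y \<longrightarrow> card Y < card X) g"
      using successively_concatD that by blast
    then have "successively (\<lambda>X Y. card X > card Y) g"
      using xss(3)[rule_format, OF that] unfolding successively_conv_nth by blast
    then have "successively (>) (map card g)" by (simp add: successively_map)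
    then show ?thesis by (simp add: successively_conv_sorted_wrt)
  qed
  define cs where "cs = map (map card) G"
  define d where "d = map sum_list cs"
  have ccs: "concat cs = map card C" by (simp add: cs_def map_concat[symmetric] CG)
  have csne: "[] \<notin> set cs" using Gne by (auto simp: cs_def)
  have ty: "comp_type (map card C) = (lam, m)" using C by (simp add: facets_def)
  have d_split: "butlast d = map (\<lambda>g. sum_list (map card g)) xss" "last d = m" "d \<noteq> []"
    using cards(2) by (simp_all add: d_def cs_def G_def o_def)
  have sumd: "sum_list d = n"
    using comp_typeD(3)[OF ty] facet_facts(2)[OF C] unfolding d_def sum_list_concat[symmetric] ccs by simp
  have xlam: "set (map card g) \<subseteq> set_mset lam" if "g \<in> set xss" for g
    unfolding cards(1)[symmetric] set_mset_mset set_map xss(1)[symmetric] set_concat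
    using that by blast
  have dpos: "0 \<notin> set d"
  proof
    assume "0 \<in> set d"
    then obtain g where g: "g \<in> set G" "sum_list (map card g) = 0" by (auto simp: d_def cs_def)
    then obtain X where X: "X \<in> set g" using Gne by (metis ex_in_conv set_empty2)
    then have "card X = 0" using g(2) by (simp del: sum_list_eq_0_iff add: sum_list_eq_0_iff)
    then show False using WF(4)[OF GC[OF g(1) X]] by simp
  qed
  have dV: "d \<in> V lam m n"
  proof -
    have "d \<in> pointed_compositions n"
      using d_split(3) sumd dpos by (auto simp: pointed_compositions_def dest: in_set_butlastD)
    moreover have "comp_le (map card C) d"
      unfolding comp_le_def using csne ccs d_def by metis
    moreover have "map card C \<in> pointed_compositions n"
      using comp_typeD(1)[OF ty] facet_facts(2)[OF C] by simp
    moreover have "\<exists>S\<subseteq>set_mset lam. x = \<Sum>S" if x: "x \<in> set (butlast d)" for x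
    proof -
      obtain g where g: "g \<in> set xss" "x = sum_list (map card g)" using x unfolding d_split(1) set_map by blast
      have "distinct (map card g)" using strictly_decreasing_distinct Gdec[OF g(1)] by blast
      then have "x = \<Sum>(set (map card g))" unfolding g(2) by (rule distinct_sum_list_conv_Sum)
      then show ?thesis using xlam[OF g(1)] by blast
    qed
    ultimately show ?thesis using ty d_split(2) unfolding V_def comp_filter_def by blast
  qed
  \<comment> \<open>The knapsack property recovers the sizes of each run from their sum, so
    \<open>epsilon\<close> splits \<open>d\<close> back into the block sizes of
    \<open>C\<close>.\<close>
  have "map (part_list lam) (butlast d) = map (map card) xss"
    unfolding d_split(1) using part_list_sum_list[OF kn Gdec xlam] by simp
  then have "blocks lam d = cs"
    using d_split(2) cards(2) by (simp add: blocks_def cs_def G_def)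
  then have eps: "epsilon lam d = map card C" using ccs by (simp add: epsilon_eq_concat)
  \<comment> \<open>One word per run: these words have lengths \<open>d\<close>, are increasing, and
    meet in descents.\<close>
  define ws where "ws = map (\<lambda>g. concat (map ?sl g)) G"
  have w: "concat ws = concat (map ?sl C)"
  proof -
    have "concat ws = concat (map ?sl (concat G))"
      unfolding ws_def by (induction G) auto
    then show ?thesis by (simp add: CG)
  qed
  have lw: "map length ws = d"
    by (simp add: ws_def d_def cs_def length_concat o_def)
  define \<alpha> where "\<alpha> = word_perm (concat ws)"
  have "descent_set (length (concat ws)) (word_perm (concat ws)) = partial_sums (map length ws)"
  proof (rule descent_set_word_perm)
    show "distinct (concat ws)" unfolding w by (rule WF)
    fix e assume "e \<in> set ws"
    then obtain g where g: "g \<in> set G" "e = concat (map ?sl g)" by (auto simp: ws_def)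
    have fin: "\<forall>X\<in>set g. finite X \<and> X \<noteq> {}" using WF(4) GC[OF g(1)] by blast
    have "length e \<in> set d" using \<open>e \<in> set ws\<close> lw by (metis image_eqI set_map)
    then have "e \<noteq> []" using dpos by auto
    then show "e \<noteq> [] \<and> sorted_wrt (<) e" using sorted_concat_ascent[OF Gasc[OF g(1)] fin] g(2) by simp
  next
    show "successively (\<lambda>e f. \<exists>a\<in>set e. \<exists>b\<in>set f. b \<le> a) ws"
      unfolding ws_def successively_map
    proof (rule successively_mono[OF Gsucc])
      fix g h assume gh: "g \<in> set G" "h \<in> set G" "\<not> ascent (last g) (hd h)"
      have mem: "last g \<in> set g" "hd h \<in> set h" using gh Gne by (metis last_in_set, metis hd_in_set)
      then have fin: "finite (last g)" "finite (hd h)" using WF(4) GC gh by blast+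
      obtain a b where ab: "a \<in> last g" "b \<in> hd h" "b \<le> a" using gh(3) by (auto simp: ascent_def not_less)
      show "\<exists>a\<in>set (concat (map ?sl g)). \<exists>b\<in>set (concat (map ?sl h)). b \<le> a"
      proof (intro bexI)
        show "a \<in> set (concat (map ?sl g))" using mem(1) fin(1) ab(1) by (auto intro!: bexI[of _ "last g"])
        show "b \<in> set (concat (map ?sl h))" using mem(2) fin(2) ab(2) by (auto intro!: bexI[of _ "hd h"])
      qed (fact ab(3))
    qed
  qed
  then have desc: "partial_sums d = descent_set n \<alpha>"
    using WF(1) by (simp add: lw \<alpha>_def w)
  have "\<alpha> permutes {1..n}"
    using word_perm_permutes[of "concat (map ?sl C)"] WF by (simp add: \<alpha>_def w del: set_concat)
  moreover have "descent_composition n \<alpha> = d"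
    using descent_composition_eqI[OF d_split(3) dpos desc sumd] .
  moreover have "sigma \<alpha> (epsilon lam d) = C"
    unfolding eps \<alpha>_def w using sigma_word_perm[of C] WF(4) by blast
  ultimately show ?thesis using dV by blast
qed

end

section \<open>Leading terms of the cycles\<close>

lemma less_of_consecutive_less:
  fixes f :: "nat \<Rightarrow> 'a::order"
  assumes "\<And>j. a \<le> j \<Longrightarrow> j < b \<Longrightarrow> f j < f (Suc j)" "a \<le> p" "p < q" "q \<le> b"
  shows "f p < f q"
  using \<open>p < q\<close> \<open>q \<le> b\<close>
proof (induction q)
  case (Suc q)
  then have "f q < f (Suc q)" using assms(1,2) by simp
  then show ?case using Suc by (cases "p = q") (auto intro: order.strict_trans)
qed simp

section \<open>Words and keys of \<open>sigma\<close>\<close>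

lemma mset_sorted_image_row:
  assumes "inj \<beta>"
  shows "mset (sorted_list_of_set (\<beta> ` row_interval c i)) = mset (map \<beta> (row_list c i))"
proof -
  have "mset (row_list c i) = mset_set (row_interval c i)"
    by (metis distinct_upt mset_set_set row_list_def set_row_list)
  moreover have "image_mset \<beta> (mset_set (row_interval c i)) = mset_set (\<beta> ` row_interval c i)"
    using assms by (intro image_mset_mset_set) (rule inj_on_subset, auto)
  ultimately show ?thesis by (simp add: mset_sorted_list_of_set)
qed

lemma map_perm_eq_concat: "map \<beta> [1..<Suc (sum_list c)] = concat (map (\<lambda>i. map \<beta> (row_list c i)) [0..<length c])"
  unfolding concat_row_list[symmetric] by (simp add: map_concat o_def)

lemma word_sigma: "concat (map sorted_list_of_set (sigma \<beta> c)) =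
    concat (map (\<lambda>i. sorted_list_of_set (\<beta> ` row_interval c i)) [0..<length c])"
  by (simp add: sigma_def o_def)

text \<open>The word of a facet sorts each row of the one-line word, and sorting a row can only
  lower it lexicographically.\<close>

lemma word_sigma_le:
  assumes "inj \<beta>"
  shows "concat (map sorted_list_of_set (sigma \<beta> c)) \<le> map \<beta> [1..<Suc (sum_list c)]"
  unfolding word_sigma map_perm_eq_concat
proof (rule concat_le_concat, unfold list_all2_map1 list_all2_map2, rule list.rel_refl_strong, rule conjI)
  fix i
  show "length (sorted_list_of_set (\<beta> ` row_interval c i)) = length (map \<beta> (row_list c i))"
    using mset_sorted_image_row[OF assms] by (metis size_mset)
  show "sorted_list_of_set (\<beta> ` row_interval c i) \<le> map \<beta> (row_list c i)"
    by (rule sorted_le_of_mset_eq[OF mset_sorted_image_row[OF assms]]) simp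
qed

lemma length_word_sigma:
  assumes "inj \<beta>"
  shows "length (concat (map sorted_list_of_set (sigma \<beta> c))) = sum_list c"
proof -
  have "map (card \<circ> (\<lambda>i. \<beta> ` row_interval c i)) [0..<length c] = map (\<lambda>i. c ! i) [0..<length c]"
    using assms by (intro map_cong) (auto simp: card_image inj_on_subset row_interval_def psum_Suc)
  then show ?thesis
    unfolding word_sigma by (simp add: length_concat o_def map_nth)
qed

lemma map_card_sigma:
  assumes "inj \<beta>"
  shows "map card (sigma \<beta> c) = c"
  by (rule nth_equalityI) (use assms in \<open>auto simp: card_image inj_on_subset row_interval_def psum_Suc\<close>)

lemma word_sigma_eq:
  assumes "inj \<beta>" "\<And>i p q. i < length c \<Longrightarrow> p \<in> row_interval c i \<Longrightarrow> q \<in> row_interval c i \<Longrightarrow> p < q \<Longrightarrow> \<beta> p < \<beta> q"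
  shows "concat (map sorted_list_of_set (sigma \<beta> c)) = map \<beta> [1..<Suc (sum_list c)]"
  unfolding word_sigma map_perm_eq_concat
proof (intro arg_cong[of _ _ concat] map_cong refl)
  fix i assume "i \<in> set [0..<length c]"
  then have i: "i < length c" by simp
  have "sorted_wrt (<) (row_list c i)" by (simp add: row_list_def del: upt_Suc)
  then have "sorted_wrt (<) (map \<beta> (row_list c i))"
    unfolding sorted_wrt_map by (rule sorted_wrt_mono_rel[rotated]) (use assms(2)[OF i] in \<open>auto simp: set_row_list\<close>)
  then show "sorted_list_of_set (\<beta> ` row_interval c i) = map \<beta> (row_list c i)"
    by (metis set_map set_row_list sorted_list_of_set.idem_if_sorted_distinct strict_sorted_iff)
qed

lemma key_sigma: "inj \<beta> \<Longrightarrow> key (sigma \<beta> c) = concat (map sorted_list_of_set (sigma \<beta> c)) @ c"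
  by (simp add: key_def map_card_sigma)

text \<open>Let \<open>p\<close> be the first position that \<gamma> moves. All earlier positions
  are fixed, so \<gamma> moves \<open>p\<close> to the right within its column. Along a column every
  step is a descent of \<alpha>, so the letter at \<open>p\<close> becomes smaller.\<close>

lemma column_permuted_less:
  assumes \<alpha>: "\<alpha> permutes {1..n}" and desc: "partial_sums d = descent_set n \<alpha>" and sum: "sum_list d = n"
    and \<gamma>: "\<gamma> \<in> young_subgroup (column_intervals d)" "\<gamma> \<noteq> id"
  shows "map (\<alpha> \<circ> \<gamma>) [1..<Suc n] < map \<alpha> [1..<Suc n]"
proof -
  have perm: "\<gamma> permutes {1..n}" using \<gamma>(1) by (simp add: young_subgroup_def Union_column_intervals sum)
  have "\<exists>p. \<gamma> p \<noteq> p" using \<gamma>(2) by auto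
  then obtain p where p: "\<gamma> p \<noteq> p" "\<And>q. q < p \<Longrightarrow> \<gamma> q = q"
    using exists_least_iff[of "\<lambda>p. \<gamma> p \<noteq> p"] by auto
  have pn: "p \<in> {1..n}" using p(1) perm by (meson permutes_not_in)
  obtain K where K: "K \<in> column_intervals d" "p \<in> K"
    using column_interval_exists[of p d] pn sum by auto
  have "\<gamma> p \<in> K" using \<gamma>(1) K by (auto simp: young_subgroup_def)
  obtain a b where ab: "K = {a..b}" "1 \<le> a" "b \<le> n" "\<And>j. a \<le> j \<Longrightarrow> j < b \<Longrightarrow> j \<in> partial_sums d"
    using K(1) sum by (auto simp: column_intervals_def)
  have "p < \<gamma> p"
  proof (rule ccontr)
    assume "\<not> p < \<gamma> p"
    then have "\<gamma> (\<gamma> p) = \<gamma> p" using p by simp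
    then show False using p(1) perm by (metis permutes_inverses(2))
  qed
  \<comment> \<open>Negation, which needs integers, turns decrease along the column into the
    increase that \<open>less_of_consecutive_less\<close> expects.\<close>
  have "- int (\<alpha> p) < - int (\<alpha> (\<gamma> p))"
  proof (rule less_of_consecutive_less[of a b "\<lambda>j. - int (\<alpha> j)"])
    fix j assume "a \<le> j" "j < b"
    then have "j \<in> descent_set n \<alpha>" using ab(4) desc by simp
    then show "- int (\<alpha> j) < - int (\<alpha> (Suc j))" by (simp add: descent_set_def)
  qed (use \<open>p < \<gamma> p\<close> K(2) \<open>\<gamma> p \<in> K\<close> ab(1) in auto)
  then have lt: "(\<alpha> \<circ> \<gamma>) p < \<alpha> p" by simp
  show ?thesis
  proof (rule less_list_of_first_difference[of "p - 1"])
    show "take (p - 1) (map (\<alpha> \<circ> \<gamma>) [1..<Suc n]) = take (p - 1) (map \<alpha> [1..<Suc n])"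
      using p(2) by (intro nth_equalityI) (auto simp del: upt_Suc)
  qed (use lt pn in \<open>auto simp del: upt_Suc\<close>)
qed

context pointed_knapsack
begin

text \<open>Since \<open>c\<close> refines \<open>d\<close>, the descents of \<alpha> fall on row
  ends of \<open>c\<close>, never inside a row.\<close>

lemma partial_sums_refine:
  assumes d: "d \<in> V lam m n" and c: "c \<in> W lam m n d"
  shows "partial_sums d \<subseteq> partial_sums c"
proof
  fix x assume "x \<in> partial_sums d"
  then obtain r where r: "x = psum d r" "1 \<le> r" "r < length d" by (auto simp: partial_sums_def)
  obtain \<rho> where \<rho>: "\<rho> \<in> row_group d" "c = permuted (epsilon lam d) \<rho>" using c W_eq_permuted(1)[OF d] by auto
  let ?t = "part_counts lam d"
  have lt: "length ?t = length d" using V_facts(1)[OF d] by (simp add: part_counts_def)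
  have t0: "0 \<notin> set ?t" using V_facts(6)[OF d] by (auto simp: part_counts_eq)
  have "x = psum c (psum ?t r)" using psum_permuted[OF d \<rho>(1), of r] r \<rho>(2) by simp
  moreover have "1 \<le> psum ?t r" using psum_strict_mono[OF t0, of 0 r] r lt by simp
  moreover have "psum ?t r < length c"
    using psum_strict_mono[OF t0, of r "length ?t"] r lt sum_part_counts[OF d] W_facts(4)[OF d c] by simp
  ultimately show "x \<in> partial_sums c" by (auto simp: partial_sums_def)
qed

lemma epsilon_in_W: "d \<in> V lam m n \<Longrightarrow> epsilon lam d \<in> W lam m n d"
  by (metis permuted_id permuted_in_W young_subgroup_id)

lemma comp_sign_epsilon: "d \<in> V lam m n \<Longrightarrow> comp_sign lam d (epsilon lam d) = 1"
  using W_eq_permuted(3)[of d id] by (simp add: permuted_id young_subgroup_id)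

text \<open>Within each row the decreasing arrangement is lexicographically the largest.\<close>

lemma W_le_epsilon:
  assumes d: "d \<in> V lam m n" and c: "c \<in> W lam m n d"
  shows "c \<le> epsilon lam d"
proof -
  obtain cs where cs: "c = concat cs" "list_all2 mset_eq cs (blocks lam d)" using V_facts(11)[OF d] c by blast
  have "list_all2 (\<lambda>xs ys. length xs = length ys \<and> xs \<le> ys) cs (blocks lam d)"
  proof (rule list_all2_all_nthI)
    show len: "length cs = length (blocks lam d)" using cs(2) by (rule list_all2_lengthD)
    fix i assume i: "i < length cs"
    have eq: "mset (cs ! i) = mset (blocks lam d ! i)" using cs(2) i by (auto simp: list_all2_conv_all_nth)
    have "sorted_wrt (>) (blocks lam d ! i)" using V_facts(6)[OF d] i len by simp
    then have "sorted_wrt (\<ge>) (blocks lam d ! i)" by (rule sorted_wrt_mono_rel[rotated]) simp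
    then show "length (cs ! i) = length (blocks lam d ! i) \<and> cs ! i \<le> blocks lam d ! i"
      using eq le_rev_sorted_of_mset_eq by (metis size_mset)
  qed
  then show ?thesis unfolding cs(1) epsilon_eq_concat by (rule concat_le_concat)
qed

definition index_set :: "(nat list \<times> (nat \<Rightarrow> nat)) set" where
  "index_set = {(d, \<alpha>). d \<in> V lam m n \<and> \<alpha> permutes {1..n} \<and> descent_composition n \<alpha> = d}"

lemma index_setD:
  assumes "(d, \<alpha>) \<in> index_set"
  shows "d \<in> V lam m n" "\<alpha> permutes {1..n}" "partial_sums d = descent_set n \<alpha>" "inj \<alpha>"
  using assms descent_composition_partial_sums[OF n_pos, of \<alpha>] permutes_inj
  by (auto simp: index_set_def)

lemma column_group_permutes: "d \<in> V lam m n \<Longrightarrow> \<gamma> \<in> column_group d \<Longrightarrow> \<gamma> permutes {1..n}"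
  using V_facts(3) by (simp add: young_subgroup_def Union_column_intervals)

text \<open>Inside a row of \<open>c\<close> there is no descent of \<alpha>, so sorting the row
  changes nothing. The word is therefore the same for all \<open>c\<close>, which is the tie that
  the sizes have to break.\<close>

lemma word_leading:
  assumes I: "(d, \<alpha>) \<in> index_set" and c: "c \<in> W lam m n d"
  shows "concat (map sorted_list_of_set (sigma \<alpha> c)) = map \<alpha> [1..<Suc n]"
proof -
  note D = index_setD[OF I]
  have sc: "sum_list c = n" using W_facts(5)[OF D(1) c] .
  have "concat (map sorted_list_of_set (sigma \<alpha> c)) = map \<alpha> [1..<Suc (sum_list c)]"
  proof (rule word_sigma_eq[OF D(4)])
    fix i p q assume i: "i < length c" and pq: "p \<in> row_interval c i" "q \<in> row_interval c i" "p < q"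
    show "\<alpha> p < \<alpha> q"
    proof (rule less_of_consecutive_less[of p q \<alpha>])
      fix j assume j: "p \<le> j" "j < q"
      have jr: "j \<in> row_interval c i" "Suc j \<in> row_interval c i" using j pq by (auto simp: row_interval_def)
      then have "j \<notin> descent_set n \<alpha>"
        using partial_sum_not_in_row partial_sums_refine[OF D(1) c] D(3) by blast
      moreover have "j \<in> {1..n}" "Suc j \<in> {1..n}"
        using jr i UN_row_interval[of c] sc by blast+
      ultimately have "\<not> \<alpha> j > \<alpha> (Suc j)" by (auto simp: descent_set_def)
      moreover have "\<alpha> j \<noteq> \<alpha> (Suc j)" using D(4) by (metis injD n_not_Suc_n)
      ultimately show "\<alpha> j < \<alpha> (Suc j)" by simp
    qed (use pq in auto)
  qed
  then show ?thesis by (simp only: sc)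
qed

lemma key_leading: "(d, \<alpha>) \<in> index_set \<Longrightarrow> key (sigma \<alpha> (epsilon lam d)) = map \<alpha> [1..<Suc n] @ epsilon lam d"
  using index_setD[of d \<alpha>] word_leading epsilon_in_W key_sigma by metis

text \<open>A nontrivial \<gamma> lowers the one-line word, and sorting the rows can only lower it
  further. For trivial \<gamma> the words tie and \<open>W_le_epsilon\<close> decides.\<close>

lemma key_less_leading:
  assumes I: "(d, \<alpha>) \<in> index_set" and c: "c \<in> W lam m n d" and \<gamma>: "\<gamma> \<in> column_group d"
    and ne: "\<gamma> \<noteq> id \<or> c \<noteq> epsilon lam d"
  shows "key (sigma (\<alpha> \<circ> \<gamma>) c) < key (sigma \<alpha> (epsilon lam d))"
proof -
  note D = index_setD[OF I]
  have inj: "inj (\<alpha> \<circ> \<gamma>)"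
    using D(4) permutes_inj[OF column_group_permutes[OF D(1) \<gamma>]] by (rule inj_compose)
  have sc: "sum_list c = n" using W_facts(5)[OF D(1) c] .
  have key: "key (sigma (\<alpha> \<circ> \<gamma>) c) = concat (map sorted_list_of_set (sigma (\<alpha> \<circ> \<gamma>) c)) @ c"
    using key_sigma[OF inj] .
  show ?thesis
  proof (cases "\<gamma> = id")
    case True
    then have "c < epsilon lam d" using ne W_le_epsilon[OF D(1) c] by simp
    then show ?thesis
      unfolding key_leading[OF I] key by (simp only: True comp_id word_leading[OF I c] append_less_append_iff)
  next
    case False
    have "concat (map sorted_list_of_set (sigma (\<alpha> \<circ> \<gamma>) c)) \<le> map (\<alpha> \<circ> \<gamma>) [1..<Suc n]"
      using word_sigma_le[OF inj, of c] unfolding sc .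
    also have "\<dots> < map \<alpha> [1..<Suc n]"
      using column_permuted_less[OF D(2,3) V_facts(3)[OF D(1)] \<gamma> False] .
    finally show ?thesis
      unfolding key_leading[OF I] key
      by (rule append_less_append[rotated]) (use length_word_sigma[OF inj, of c] sc in \<open>simp del: upt_Suc\<close>)
  qed
qed

lemma sigma_facet:
  assumes d: "d \<in> V lam m n" and c: "c \<in> W lam m n d" and \<beta>: "\<beta> permutes {1..n}"
  shows "sigma \<beta> c \<in> facets lam m n"
proof -
  note Wc = W_facts[OF d c]
  have inj: "inj \<beta>" using permutes_inj[OF \<beta>] .
  have cards: "map card (sigma \<beta> c) = c" using map_card_sigma[OF inj] .
  have "0 \<notin> set (map card (sigma \<beta> c))" using Wc(3) cards by simp
  then have "{} \<notin> set (sigma \<beta> c)" by force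
  then have "{} \<notin> set (butlast (sigma \<beta> c))" using in_set_butlastD by metis
  moreover have "sigma \<beta> c \<noteq> []" using Wc(2) length_sigma[of \<beta> c] by (metis length_0_conv)
  moreover have "\<Union>(set (sigma \<beta> c)) = \<beta> ` (\<Union>i<length c. row_interval c i)"
    unfolding image_UN by (simp add: sigma_def lessThan_atLeast0)
  then have "\<Union>(set (sigma \<beta> c)) = {1..n}" unfolding UN_row_interval Wc(5) using permutes_image[OF \<beta>] by simp
  moreover have "sigma \<beta> c ! i \<inter> sigma \<beta> c ! j = {}" if "i < j" "j < length (sigma \<beta> c)" for i j
  proof -
    have "row_interval c i \<inter> row_interval c j = {}" using row_interval_unique[of _ c i j] that by auto
    then show ?thesis using that inj by (simp add: image_Int[symmetric])
  qed
  ultimately have "sigma \<beta> c \<in> ordered_set_partitions n" unfolding ordered_set_partitions_def by blast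
  then show ?thesis using cards Wc(1) by (simp add: facets_def)
qed

lemma finite_W: "d \<in> V lam m n \<Longrightarrow> finite (W lam m n d)"
  using W_eq_permuted(1) finite_groups(2) by simp

lemma lookup_g_cycle:
  "Poly_Mapping.lookup (g_cycle lam m n \<alpha> d) C = (\<Sum>\<gamma>\<in>column_group d. \<Sum>c\<in>W lam m n d.
    if sigma (\<alpha> \<circ> \<gamma>) c = C then of_int (sign \<gamma> * comp_sign lam d c) else 0)"
  unfolding g_cycle_def by (simp add: lookup_sum lookup_single when_def del: of_int_mult)

lemma keys_g_cycle:
  assumes "C \<in> Poly_Mapping.keys (g_cycle lam m n \<alpha> d :: nat set list \<Rightarrow>\<^sub>0 'k::field)"
  obtains \<gamma> c where "\<gamma> \<in> column_group d" "c \<in> W lam m n d" "C = sigma (\<alpha> \<circ> \<gamma>) c"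
proof -
  have "Poly_Mapping.lookup (g_cycle lam m n \<alpha> d) C \<noteq> (0::'k)" using assms by (simp add: in_keys_iff)
  then obtain \<gamma> where \<gamma>: "\<gamma> \<in> column_group d" "(\<Sum>c\<in>W lam m n d.
    if sigma (\<alpha> \<circ> \<gamma>) c = C then of_int (sign \<gamma> * comp_sign lam d c) else (0::'k)) \<noteq> 0"
    unfolding lookup_g_cycle by (rule sum.not_neutral_contains_not_neutral)
  from \<gamma>(2) obtain c where c: "c \<in> W lam m n d"
    "(if sigma (\<alpha> \<circ> \<gamma>) c = C then of_int (sign \<gamma> * comp_sign lam d c) else (0::'k)) \<noteq> 0"
    by (rule sum.not_neutral_contains_not_neutral)
  from c(2) have "C = sigma (\<alpha> \<circ> \<gamma>) c" by metis
  then show ?thesis by (rule that[OF \<gamma>(1) c(1)])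
qed

text \<open>The strict inequality for all other pairs shows that the leading face arises from
  exactly one summand, so nothing can cancel or add up there; its two signs are 1.\<close>

lemma lookup_g_cycle_leading:
  assumes I: "(d, \<alpha>) \<in> index_set"
  shows "Poly_Mapping.lookup (g_cycle lam m n \<alpha> d) (sigma \<alpha> (epsilon lam d)) = (1::'k::field)"
proof -
  note D = index_setD[OF I]
  let ?f = "\<lambda>(\<gamma> :: nat \<Rightarrow> nat) c. of_int (sign \<gamma> * comp_sign lam d c) :: 'k"
  have *: "sigma (\<alpha> \<circ> \<gamma>) c = sigma \<alpha> (epsilon lam d) \<longleftrightarrow> \<gamma> = id \<and> c = epsilon lam d"
    if "\<gamma> \<in> column_group d" "c \<in> W lam m n d" for \<gamma> c
    using key_less_leading[OF I that(2,1)] by (metis comp_id order.strict_implies_not_eq)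
  have "Poly_Mapping.lookup (g_cycle lam m n \<alpha> d) (sigma \<alpha> (epsilon lam d)) =
    (\<Sum>\<gamma>\<in>column_group d. \<Sum>c\<in>W lam m n d. if \<gamma> = id \<and> c = epsilon lam d then ?f \<gamma> c else 0)"
    unfolding lookup_g_cycle by (intro sum.cong refl) (simp add: *)
  also have "\<dots> = (\<Sum>\<gamma>\<in>column_group d. if \<gamma> = id then (\<Sum>c\<in>W lam m n d. if c = epsilon lam d then ?f id c else 0) else 0)"
    by (rule sum.cong) auto
  also have "\<dots> = ?f id (epsilon lam d)"
    using finite_groups(1)[of d] finite_W[OF D(1)] epsilon_in_W[OF D(1)] young_subgroup_id by simp
  finally show ?thesis by (simp add: comp_sign_epsilon[OF D(1)])
qed

lemma g_cycle_in_cycles: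
  assumes I: "(d, \<alpha>) \<in> index_set"
  shows "(g_cycle lam m n \<alpha> d :: nat set list \<Rightarrow>\<^sub>0 'k::field) \<in> cycles (Lambda_complex lam m n) (int k - 1)"
proof -
  note D = index_setD[OF I]
  have "Poly_Mapping.keys (g_cycle lam m n \<alpha> d :: nat set list \<Rightarrow>\<^sub>0 'k) \<subseteq> facets lam m n"
  proof
    fix C assume "C \<in> Poly_Mapping.keys (g_cycle lam m n \<alpha> d :: nat set list \<Rightarrow>\<^sub>0 'k)"
    then obtain \<gamma> c where "\<gamma> \<in> column_group d" "c \<in> W lam m n d" "C = sigma (\<alpha> \<circ> \<gamma>) c"
      by (rule keys_g_cycle)
    then show "C \<in> facets lam m n"
      using sigma_facet[OF D(1)] permutes_compose[OF column_group_permutes[OF D(1)] D(2)] by simp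
  qed
  then show ?thesis using boundary_g_cycle[OF D(1)] by (simp add: cycles_def chains_Lambda)
qed

end

section \<open>The basis\<close>

context pointed_knapsack
begin

lemma finite_index_set: "finite index_set"
proof -
  have "index_set \<subseteq> (\<lambda>\<alpha>. (descent_composition n \<alpha>, \<alpha>)) ` {\<alpha>. \<alpha> permutes {1..n}}"
    by (auto simp: index_set_def)
  then show ?thesis by (rule finite_subset) (simp add: finite_permutations)
qed

abbreviation leading :: "nat list \<times> (nat \<Rightarrow> nat) \<Rightarrow> nat set list" where
  "leading x \<equiv> sigma (snd x) (epsilon lam (fst x))"

abbreviation generator :: "nat list \<times> (nat \<Rightarrow> nat) \<Rightarrow> (nat set list \<Rightarrow>\<^sub>0 'k::field)" where
  "generator x \<equiv> g_cycle lam m n (snd x) (fst x)"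

text \<open>The key of the leading face begins with the one-line word of \<alpha>, and \<alpha>
  determines \<open>d\<close>.\<close>

lemma inj_on_leading: "inj_on leading index_set"
proof (rule inj_onI, clarify)
  fix d \<alpha> d' \<alpha>' assume I: "(d, \<alpha>) \<in> index_set" "(d', \<alpha>') \<in> index_set"
    and "leading (d, \<alpha>) = leading (d', \<alpha>')"
  then have "map \<alpha> [1..<Suc n] @ epsilon lam d = map \<alpha>' [1..<Suc n] @ epsilon lam d'"
    using key_leading I by (metis fst_conv snd_conv)
  then have "map \<alpha> [1..<Suc n] = map \<alpha>' [1..<Suc n]" by (auto simp: append_eq_append_conv simp del: upt_Suc)
  then have eq: "\<alpha> j = \<alpha>' j" if "j \<in> {1..n}" for j using that unfolding map_eq_conv by (simp del: upt_Suc)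
  have "\<alpha> = \<alpha>'"
  proof
    fix j show "\<alpha> j = \<alpha>' j"
      using eq[of j] index_setD(2)[OF I(1)] index_setD(2)[OF I(2)] by (metis permutes_not_in)
  qed
  then show "d = d' \<and> \<alpha> = \<alpha>'" using I by (auto simp: index_set_def)
qed

lemma leading_coefficient: "x \<in> index_set \<Longrightarrow> Poly_Mapping.lookup (generator x) (leading x) = (1::'k::field)"
  using lookup_g_cycle_leading[of "fst x" "snd x"] by simp

lemma keys_less_leading:
  assumes "x \<in> index_set" "C \<in> Poly_Mapping.keys (generator x :: nat set list \<Rightarrow>\<^sub>0 'k::field)" "C \<noteq> leading x"
  shows "key C < key (leading x)"
proof -
  obtain \<gamma> c where C: "\<gamma> \<in> column_group (fst x)" "c \<in> W lam m n (fst x)" "C = sigma (snd x \<circ> \<gamma>) c"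
    using assms(2) by (rule keys_g_cycle)
  then have "\<gamma> \<noteq> id \<or> c \<noteq> epsilon lam (fst x)" using assms(3) by auto
  then show ?thesis unfolding C(3) using key_less_leading[of "fst x" "snd x"] assms(1) C(1,2) by simp
qed

abbreviation cycle_space :: "(nat set list \<Rightarrow>\<^sub>0 'k::field) set" where
  "cycle_space \<equiv> cycles (Lambda_complex lam m n) (int k - 1)"

lemma generator_in_cycles: "x \<in> index_set \<Longrightarrow> (generator x :: nat set list \<Rightarrow>\<^sub>0 'k::field) \<in> cycle_space"
  using g_cycle_in_cycles[of "fst x" "snd x"] by simp

lemma maximal_key_is_leading:
  fixes z :: "nat set list \<Rightarrow>\<^sub>0 'k::field"
  assumes z: "z \<in> cycle_space" and C: "C \<in> Poly_Mapping.keys z"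
    and max: "\<And>C'. C' \<in> Poly_Mapping.keys z \<Longrightarrow> key C' \<le> key C"
  shows "C \<in> leading ` index_set"
proof -
  have zs: "Poly_Mapping.keys z \<subseteq> facets lam m n" "boundary z = 0"
    using z by (auto simp: cycles_def chains_Lambda)
  have "\<exists>d \<alpha>. d \<in> V lam m n \<and> \<alpha> permutes {1..n} \<and> descent_composition n \<alpha> = d \<and> sigma \<alpha> (epsilon lam d) = C"
  proof (rule good_facet_is_leading)
    show "C \<in> facets lam m n" using zs C by blast
    show "Suc i < k \<and> card (C ! Suc i) < card (C ! i)" if "Suc i < length C" "ascent (C ! i) (C ! Suc i)" for i
      using maximal_key_of_cycle[OF zs C max that] .
  qed
  then show ?thesis by (force simp: index_set_def)
qed

lemma cycle_in_generator_span:
  fixes z :: "nat set list \<Rightarrow>\<^sub>0 'k::field"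
  assumes "z \<in> cycle_space"
  shows "\<exists>a. z = (\<Sum>x\<in>index_set. chain_scale (a x) (generator x))"
proof (rule leading_terms_span[where lead = leading and key = key and F = "facets lam m n" and Z = cycle_space])
  show "Poly_Mapping.keys z \<subseteq> facets lam m n" if "z \<in> cycle_space" for z :: "nat set list \<Rightarrow>\<^sub>0 'k"
    using that by (simp add: cycles_def chains_Lambda)
qed (use finite_index_set finite_facets inj_on_key leading_coefficient keys_less_leading generator_in_cycles
      cycles_closed maximal_key_is_leading assms in blast)+

lemma generators_independent:
  fixes a :: "nat list \<times> (nat \<Rightarrow> nat) \<Rightarrow> 'k::field"
  assumes "(\<Sum>x\<in>index_set. chain_scale (a x) (generator x)) = 0"
  shows "\<forall>x\<in>index_set. a x = 0"
  by (rule leading_terms_independent[where lead = leading and key = key and g = generator,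
        OF finite_index_set inj_on_leading leading_coefficient keys_less_leading assms])

abbreviation cls :: "(nat set list \<Rightarrow>\<^sub>0 'k::field) \<Rightarrow> (nat set list \<Rightarrow>\<^sub>0 'k) set" where
  "cls \<equiv> homology_class (Lambda_complex lam m n) (int k - 1)"

abbreviation hom :: "('k::field, (nat set list \<Rightarrow>\<^sub>0 'k) set) module" where
  "hom \<equiv> homology (Lambda_complex lam m n) (int k - 1)"

lemma cls_eq: "cls z = {z}"
  by (simp add: homology_class_def boundaries_Lambda)

text \<open>If two indices with different leading faces shared a generator, each leading key would
  be smaller than the other. Injectivity matters because \<open>lincomb\<close> attaches
  coefficients to vectors and not to indices.\<close>

lemma inj_on_generator: "inj_on (\<lambda>x. generator x :: nat set list \<Rightarrow>\<^sub>0 'k::field) index_set"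
proof (rule inj_onI)
  fix x y assume xy: "x \<in> index_set" "y \<in> index_set" "(generator x :: nat set list \<Rightarrow>\<^sub>0 'k) = generator y"
  have in_keys: "leading v \<in> Poly_Mapping.keys (generator v :: nat set list \<Rightarrow>\<^sub>0 'k)" if "v \<in> index_set" for v
    using leading_coefficient[OF that, where 'k='k] by (simp add: in_keys_iff)
  have "leading x = leading y"
  proof (rule ccontr)
    assume "leading x \<noteq> leading y"
    then have "key (leading x) < key (leading y)" "key (leading y) < key (leading x)"
      using keys_less_leading[OF xy(2), where 'k='k] keys_less_leading[OF xy(1), where 'k='k]
        in_keys[OF xy(1)] in_keys[OF xy(2)] xy(3) by auto
    then show False by simp
  qed
  then show "x = y" using inj_on_leading xy by (auto dest: inj_onD)
qed

text \<open>There are no nonzero boundaries in this degree, so a class is a singleton and relations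
  between classes are relations between chains. \<open>lin\<close> makes the translation by
  induction on the indices.\<close>

lemma generators_basis:
  "vectorspace.basis class_ring (hom :: ('k::field, _) module) ((\<lambda>x. cls (generator x)) ` index_set)"
proof -
  interpret H: vectorspace "class_ring :: 'k ring" "hom :: ('k, (nat set list \<Rightarrow>\<^sub>0 'k) set) module"
    by (rule vectorspace_homology)
  let ?v = "\<lambda>x. cls (generator x) :: (nat set list \<Rightarrow>\<^sub>0 'k) set"
  have inj: "inj_on ?v index_set" using inj_on_generator by (auto simp: cls_eq inj_on_def)
  have sub: "?v ` index_set \<subseteq> carrier hom"
    using generator_in_cycles by (auto simp: homology_sel)
  have lin: "H.lincomb a (?v ` S) = cls (\<Sum>x\<in>S. chain_scale (a (?v x)) (generator x))" if S: "S \<subseteq> index_set" for a S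
  proof -
    have "finite S" using S finite_index_set finite_subset by blast
    then show ?thesis using S
    proof (induction S)
      case empty
      then show ?case by (simp add: H.lincomb_def homology_sel)
    next
      case (insert x S)
      have "H.lincomb a (?v ` S \<union> {?v x}) = a (?v x) \<odot>\<^bsub>hom\<^esub> ?v x \<oplus>\<^bsub>hom\<^esub> H.lincomb a (?v ` S)"
      proof (rule H.lincomb_insert)
        show "finite (?v ` S)" using insert.hyps(1) by simp
        show "a \<in> ?v ` S \<union> {?v x} \<rightarrow> carrier class_ring" by simp
        show "?v x \<notin> ?v ` S" using inj_on_image_mem_iff[OF inj, of x S] insert.hyps(2) insert.prems by blast
        show "?v ` S \<subseteq> carrier hom" "?v x \<in> carrier hom" using sub insert.prems by blast+
      qed
      then show ?case using insert by (simp add: homology_smult homology_add)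
    qed
  qed
  have fin: "finite (?v ` index_set)" using finite_index_set by simp
  show ?thesis unfolding H.basis_def
  proof (intro conjI sub)
    show "H.lin_indpt (?v ` index_set)"
    proof (rule H.finite_lin_indpt2[OF fin sub])
      fix a :: "_ \<Rightarrow> 'k" assume "H.lincomb a (?v ` index_set) = \<zero>\<^bsub>hom\<^esub>"
      then have "cls (\<Sum>x\<in>index_set. chain_scale (a (?v x)) (generator x)) = cls 0"
        unfolding lin[OF order_refl] homology_sel .
      then have "(\<Sum>x\<in>index_set. chain_scale (a (?v x)) (generator x)) = 0"
        unfolding cls_eq by (rule singleton_inject)
      then have "\<forall>x\<in>index_set. a (?v x) = 0" by (rule generators_independent)
      then show "\<forall>v\<in>?v ` index_set. a v = \<zero>\<^bsub>class_ring\<^esub>" by simp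
    qed
    show "H.span (?v ` index_set) = carrier hom"
    proof
      show "H.span (?v ` index_set) \<subseteq> carrier hom" using sub by (rule H.span_is_subset2)
      show "carrier hom \<subseteq> H.span (?v ` index_set)"
      proof
        fix X assume "X \<in> carrier (hom :: ('k, _) module)"
        then obtain z where z: "X = cls z" "z \<in> cycle_space" by (auto simp: homology_sel)
        obtain a where a: "z = (\<Sum>x\<in>index_set. chain_scale (a x) (generator x))"
          using cycle_in_generator_span[OF z(2)] by blast
        \<comment> \<open>Carries the coefficients from indices over to classes, along the inverse
          of the injective map \<open>?v\<close>.\<close>
        define b where "b = a \<circ> the_inv_into index_set ?v"
        have "X = H.lincomb b (?v ` index_set)"
          unfolding lin[OF order_refl] z(1) a
          by (intro arg_cong[of _ _ cls] sum.cong) (auto simp: b_def the_inv_into_f_f[OF inj])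
        then show "X \<in> H.span (?v ` index_set)"
          unfolding H.span_def using fin
          by (intro CollectI exI[of _ b] exI[of _ "?v ` index_set"]) simp
      qed
    qed
  qed
qed

end

theorem theorem9p4:
  fixes lam :: "nat multiset" and m n k :: nat
  assumes "pointed_knapsack_partition lam m n"
    and "m > 0"
    and "size lam = k"
  shows "let \<Lambda> = Lambda_complex lam m n;
             p = int k - 1;
             I = {(d, \<alpha>). d \<in> V lam m n \<and> \<alpha> permutes {1..n} \<and> descent_composition n \<alpha> = d};
             g = (\<lambda>(d, \<alpha>). g_cycle lam m n \<alpha> d :: nat set list \<Rightarrow>\<^sub>0 'k::field)
         in (\<forall>x\<in>I. g x \<in> cycles \<Lambda> p) \<and>
            inj_on (\<lambda>x. homology_class \<Lambda> p (g x)) I \<and>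
            vectorspace.basis class_ring (homology \<Lambda> p) ((\<lambda>x. homology_class \<Lambda> p (g x)) ` I)"
proof -
  interpret pointed_knapsack lam m n k using assms by unfold_locales
  have g: "(\<lambda>(d, \<alpha>). g_cycle lam m n \<alpha> d :: nat set list \<Rightarrow>\<^sub>0 'k) = (\<lambda>x. generator x)"
    by (simp add: case_prod_unfold)
  have "inj_on (\<lambda>x. cls (generator x :: nat set list \<Rightarrow>\<^sub>0 'k)) index_set"
    using inj_on_generator by (auto simp: cls_eq inj_on_def)
  then show ?thesis
    unfolding Let_def g index_set_def[symmetric]
    using generator_in_cycles generators_basis by blast
qed

end
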